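(* Let $UF$ denote the class of countable graphs $G$ such that each component of $G$ is finite. Then $|UF|_<=\aleph_0$ if and only if the finite graphs are well-quasi-ordered under the minor relation $<$.
   Context: $G<H$ ($G$ is a minor of $H$) means that there are pairwise disjoint (non-empty) connected subgraphs $B_v$, $v\in V(G)$, of $H$ and edges $E_{uv}$, $uv\in E(G)$, of $H$ such that each $E_{uv}$ has one end-vertex in $B_u$ and one in $B_v$. Graphs $G,H$ are minor-twins if $G<H$ and $H<G$; for a class $\mathcal C$ of graphs, $|\mathcal C|_<$ is the cardinality of the set of minor-twin classes of elements of $\mathcal C$. A quasi-order $(Q,\leq)$ is well-quasi-ordered if for every sequence $(q_n)_{n\in\mathbb N}$ in $Q$ there are $i<j$ with $q_i\leq q_j$. *)

theory Defs
  imports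
    "HOL-Library.Countable_Set"
    "HOL-Library.Disjoint_Sets"
    "HOL-Library.Infinite_Typeclass"
begin

unbundle cardinal_syntax

record 'a graph =
  verts :: "'a set"
  edges :: "'a set set"

definition simple_graph :: "'a graph \<Rightarrow> bool" where
  "simple_graph G \<longleftrightarrow> (\<forall>e\<in>edges G. e \<subseteq> verts G \<and> card e = 2)"

definition subgraph :: "'a graph \<Rightarrow> 'a graph \<Rightarrow> bool" where
  "subgraph H G \<longleftrightarrow> simple_graph H \<and> simple_graph G \<and>
     verts H \<subseteq> verts G \<and> edges H \<subseteq> edges G"

definition adj_rel :: "'a graph \<Rightarrow> 'a rel" where
  "adj_rel G = {(x, y). {x, y} \<in> edges G}"

(* The empty graph is a graph, but it does not count as connected. *)
definition connected_graph :: "'a graph \<Rightarrow> bool" where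
  "connected_graph G \<longleftrightarrow> simple_graph G \<and> verts G \<noteq> {} \<and>
     (\<forall>x\<in>verts G. \<forall>y\<in>verts G. (x, y) \<in> (adj_rel G)\<^sup>*)"

definition component :: "'a graph \<Rightarrow> 'a graph \<Rightarrow> bool" where
  "component C G \<longleftrightarrow> subgraph C G \<and> connected_graph C \<and>
     (\<forall>D. subgraph D G \<and> connected_graph D \<and> subgraph C D \<longrightarrow> D = C)"

(* B v is the branch set of v and F {u, v} is the edge E_uv.  The two graphs may have different
   vertex types, so minor is a relation between graphs up to isomorphism. *)
definition minor :: "'a graph \<Rightarrow> 'b graph \<Rightarrow> bool" where
  "minor G H \<longleftrightarrow> (\<exists>(B :: 'a \<Rightarrow> 'b graph) (F :: 'a set \<Rightarrow> 'b set).
     (\<forall>v\<in>verts G. subgraph (B v) H \<and> connected_graph (B v)) \<and>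
     disjoint_family_on (\<lambda>v. verts (B v)) (verts G) \<and>
     (\<forall>u v. {u, v} \<in> edges G \<longrightarrow>
        F {u, v} \<in> edges H \<and>
        (\<exists>x\<in>verts (B u). \<exists>y\<in>verts (B v). F {u, v} = {x, y})))"

definition minor_twins :: "'a graph \<Rightarrow> 'b graph \<Rightarrow> bool" where
  "minor_twins G H \<longleftrightarrow> minor G H \<and> minor H G"

definition twin_classes :: "'a graph set \<Rightarrow> 'a graph set set" where
  "twin_classes \<C> = \<C> // {(G, H). G \<in> \<C> \<and> H \<in> \<C> \<and> minor_twins G H}"

definition card_minor :: "'a graph set \<Rightarrow> 'a graph set rel" where
  "card_minor \<C> = |twin_classes \<C>|"

definition well_quasi_ordered :: "'a set \<Rightarrow> ('a \<Rightarrow> 'a \<Rightarrow> bool) \<Rightarrow> bool" where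
  "well_quasi_ordered Q le \<longleftrightarrow> reflp_on Q le \<and> transp_on Q le \<and>
     (\<forall>q :: nat \<Rightarrow> 'a. range q \<subseteq> Q \<longrightarrow> (\<exists>i j. i < j \<and> le (q i) (q j)))"

(* Classes of graphs are represented by the sets of their members with vertices in a type 'a.
   Every countable graph has an isomorphic copy over 'a as soon as 'a is infinite, so for such 'a
   no twin class is lost; hence the sort constraint. *)
definition UF :: "'a::infinite graph set" where
  "UF = {G. simple_graph G \<and> countable (verts G) \<and> (\<forall>C. component C G \<longrightarrow> finite (verts C))}"

definition finite_graphs :: "'a::infinite graph set" where
  "finite_graphs = {G. simple_graph G \<and> finite (verts G)}"

end

theory Submission
  imports Defs
begin

text \<open>
  Edgeless graphs of different finite orders are not minor-twins, so \<open>UF\<close> always has infinitely many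
  twin classes, and the question is when it has only countably many.

  Suppose that the finite graphs are well-quasi-ordered.  Then a graph \<open>G\<close> in \<open>UF\<close> is determined up
  to twins by the set of its finite minors (\<open>minor_if_fin_minors_subset\<close>).  Call a component of
  \<open>G\<close> recurrent if it is a minor of infinitely many components of \<open>G\<close>.  Among infinitely
  many components, one is a minor of infinitely many others (\<open>wqo_infinite_above\<close>), so only finitely
  many are not recurrent, and together these form a finite minor of \<open>G\<close>.  If every finite
  minor of \<open>G\<close> is a minor of \<open>H\<close>, then this finite part embeds into finitely many components of
  \<open>H\<close>.  A recurrent component is a minor of infinitely many components of \<open>H\<close>, since \<open>G\<close>, and
  hence \<open>H\<close>, contains arbitrarily many disjoint copies of it as minors.  So the recurrent components
  can be placed one after the other into components of \<open>H\<close> not used before.  The set of finite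
  minors is closed downwards, and a countable well-quasi-order has only countably many
  down-closed subsets, because the complement of each of them is generated by a finite set
  (\<open>countable_down_closed_sets\<close>).

  Conversely, from a bad sequence of finite graphs one extracts an infinite antichain, because
  the orders of its members tend to infinity (\<open>infinite_antichain\<close>).  Adding an apex vertex to
  each of its members makes them connected and creates no new minor relation between them
  (\<open>minor_if_minor_cone\<close>).  A connected minor of a disjoint union is a minor of one of the
  summands, so the disjoint unions over different subsets of this antichain are not twins, and
  there are uncountably many twin classes (\<open>uncountable_twin_classes_UF\<close>).
\<close>

section \<open>Models of minors by connected vertex sets\<close>

text \<open>Connectedness is expressed by closed subsets instead of walks: a set containing one vertex
  of \<open>S\<close> and closed under adjacency within \<open>S\<close> contains all of \<open>S\<close>.  This gives an induction
  principle and makes unions of branch sets easy to handle.\<close>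

definition connected_set :: "'a graph \<Rightarrow> 'a set \<Rightarrow> bool" where
  "connected_set G S \<longleftrightarrow> S \<noteq> {} \<and> S \<subseteq> verts G \<and>
     (\<forall>A. A \<inter> S \<noteq> {} \<longrightarrow> (\<forall>x\<in>A \<inter> S. \<forall>y\<in>S. {x, y} \<in> edges G \<longrightarrow> y \<in> A) \<longrightarrow> S \<subseteq> A)"

text \<open>Only the vertex sets of the branch graphs are recorded.  The branch graphs can be taken to be
  induced, and an edge between two branch sets can be chosen afterwards.\<close>

definition model :: "'a graph \<Rightarrow> 'b graph \<Rightarrow> ('a \<Rightarrow> 'b set) \<Rightarrow> bool" where
  "model G H \<beta> \<longleftrightarrow> (\<forall>v\<in>verts G. connected_set H (\<beta> v)) \<and> disjoint_family_on \<beta> (verts G) \<and>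
     (\<forall>u v. {u, v} \<in> edges G \<longrightarrow> (\<exists>x\<in>\<beta> u. \<exists>y\<in>\<beta> v. {x, y} \<in> edges H))"

definition induced :: "'a graph \<Rightarrow> 'a set \<Rightarrow> 'a graph" where
  "induced G S = \<lparr>verts = S, edges = {e \<in> edges G. e \<subseteq> S}\<rparr>"

lemma verts_induced [simp]: "verts (induced G S) = S"
  by (simp add: induced_def)

lemma edges_induced: "e \<in> edges (induced G S) \<longleftrightarrow> e \<in> edges G \<and> e \<subseteq> S"
  by (simp add: induced_def)

lemma simple_induced: "simple_graph G \<Longrightarrow> simple_graph (induced G S)"
  by (simp add: simple_graph_def edges_induced)

lemma simple_edgeD:
  assumes "simple_graph G" "{x, y} \<in> edges G"
  shows "x \<in> verts G" "y \<in> verts G" "x \<noteq> y"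
  using assms by (fastforce simp: simple_graph_def)+

lemma connected_setD:
  "connected_set G S \<Longrightarrow> x \<in> A \<Longrightarrow> x \<in> S \<Longrightarrow>
    (\<And>x y. x \<in> A \<Longrightarrow> x \<in> S \<Longrightarrow> y \<in> S \<Longrightarrow> {x, y} \<in> edges G \<Longrightarrow> y \<in> A) \<Longrightarrow> S \<subseteq> A"
  unfolding connected_set_def by blast

lemma connected_setI:
  assumes "S \<noteq> {}" "S \<subseteq> verts G"
    and "\<And>A x z. x \<in> A \<Longrightarrow> x \<in> S \<Longrightarrow> z \<in> S \<Longrightarrow>
      (\<And>x y. x \<in> A \<Longrightarrow> x \<in> S \<Longrightarrow> y \<in> S \<Longrightarrow> {x, y} \<in> edges G \<Longrightarrow> y \<in> A) \<Longrightarrow> z \<in> A"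
  shows "connected_set G S"
  unfolding connected_set_def using assms by blast

lemma connected_set_singleton: "v \<in> verts G \<Longrightarrow> connected_set G {v}"
  by (auto simp: connected_set_def)

lemma connected_subgraph_verts:
  assumes "subgraph C G" "connected_graph C"
  shows "connected_set G (verts C)"
proof (rule connected_setI)
  show "verts C \<noteq> {}" "verts C \<subseteq> verts G"
    using assms by (auto simp: subgraph_def connected_graph_def)
next
  fix A x z
  assume x: "x \<in> A" "x \<in> verts C" and z: "z \<in> verts C"
    and closed: "\<And>x y. x \<in> A \<Longrightarrow> x \<in> verts C \<Longrightarrow> y \<in> verts C \<Longrightarrow> {x, y} \<in> edges G \<Longrightarrow> y \<in> A"
  have C: "simple_graph C" "edges C \<subseteq> edges G"
    using assms(1) by (auto simp: subgraph_def)
  have "(x, z) \<in> (adj_rel C)\<^sup>*"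
    using assms x z by (auto simp: connected_graph_def)
  then have "z \<in> A \<and> z \<in> verts C"
  proof (induction rule: rtrancl_induct)
    case base
    then show ?case using x by blast
  next
    case (step y z)
    then have "{y, z} \<in> edges C" by (simp add: adj_rel_def)
    then show ?case
      using step C closed[of y z] simple_edgeD(2)[of C y z] by blast
  qed
  then show "z \<in> A" by blast
qed

lemma connected_graph_induced:
  assumes "simple_graph G" "connected_set G S"
  shows "connected_graph (induced G S)"
  unfolding connected_graph_def
proof (intro conjI ballI)
  show "simple_graph (induced G S)" using assms(1) by (rule simple_induced)
  show "verts (induced G S) \<noteq> {}" using assms(2) by (simp add: connected_set_def)
next
  fix x y assume xy: "x \<in> verts (induced G S)" "y \<in> verts (induced G S)"
  have "S \<subseteq> {y. (x, y) \<in> (adj_rel (induced G S))\<^sup>*}"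
  proof (rule connected_setD[OF assms(2), of x])
    fix y z
    assume "y \<in> {y. (x, y) \<in> (adj_rel (induced G S))\<^sup>*}" "y \<in> S" "z \<in> S" "{y, z} \<in> edges G"
    then show "z \<in> {y. (x, y) \<in> (adj_rel (induced G S))\<^sup>*}"
      by (auto simp: adj_rel_def edges_induced intro: rtrancl_into_rtrancl)
  qed (use xy in auto)
  then show "(x, y) \<in> (adj_rel (induced G S))\<^sup>*" using xy by auto
qed

lemma subgraph_induced:
  "simple_graph G \<Longrightarrow> S \<subseteq> verts G \<Longrightarrow> subgraph (induced G S) G"
  by (auto simp: subgraph_def simple_induced edges_induced)

lemma minor_iff_model:
  fixes G :: "'a graph" and H :: "'b graph"
  assumes G: "simple_graph G" and H: "simple_graph H"
  shows "minor G H \<longleftrightarrow> (\<exists>\<beta>. model G H \<beta>)"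
proof
  assume "minor G H"
  then obtain B F where B: "\<forall>v\<in>verts G. subgraph (B v) H \<and> connected_graph (B v)"
     and D: "disjoint_family_on (\<lambda>v. verts (B v)) (verts G)"
     and F: "\<forall>u v. {u, v} \<in> edges G \<longrightarrow> F {u, v} \<in> edges H \<and>
        (\<exists>x\<in>verts (B u). \<exists>y\<in>verts (B v). F {u, v} = {x, y})"
    unfolding minor_def by blast
  have "model G H (\<lambda>v. verts (B v))"
    unfolding model_def
  proof (intro conjI allI impI)
    show "\<forall>v\<in>verts G. connected_set H (verts (B v))"
      using B connected_subgraph_verts by blast
    show "disjoint_family_on (\<lambda>v. verts (B v)) (verts G)" by (rule D)
    fix u v assume "{u, v} \<in> edges G"
    then have "F {u, v} \<in> edges H" "\<exists>x\<in>verts (B u). \<exists>y\<in>verts (B v). F {u, v} = {x, y}"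
      using F by blast+
    then show "\<exists>x\<in>verts (B u). \<exists>y\<in>verts (B v). {x, y} \<in> edges H" by metis
  qed
  then show "\<exists>\<beta>. model G H \<beta>" by blast
next
  assume "\<exists>\<beta>. model G H \<beta>"
  then obtain \<beta> where \<beta>: "model G H \<beta>" ..
  \<comment> \<open>The chosen edge may depend on the set \<open>{u, v}\<close> only; it serves both orders of its ends because
    it is itself an unordered pair.\<close>
  have "\<exists>F. \<forall>e\<in>edges G. F e \<in> edges H \<and>
      (\<forall>u v. e = {u, v} \<longrightarrow> (\<exists>x\<in>\<beta> u. \<exists>y\<in>\<beta> v. F e = {x, y}))"
  proof (rule bchoice, rule ballI)
    fix e assume e: "e \<in> edges G"
    then have "card e = 2" using G by (simp add: simple_graph_def)
    then obtain u v where uv: "e = {u, v}" "u \<noteq> v" by (meson card_2_iff)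
    then obtain x y where "x \<in> \<beta> u" "y \<in> \<beta> v" "{x, y} \<in> edges H"
      using \<beta> e unfolding model_def by blast
    then show "\<exists>f. f \<in> edges H \<and> (\<forall>u v. e = {u, v} \<longrightarrow> (\<exists>x\<in>\<beta> u. \<exists>y\<in>\<beta> v. f = {x, y}))"
      using uv by (intro exI[of _ "{x, y}"]) (auto simp: doubleton_eq_iff insert_commute)
  qed
  then obtain F where F: "\<forall>e\<in>edges G. F e \<in> edges H \<and>
      (\<forall>u v. e = {u, v} \<longrightarrow> (\<exists>x\<in>\<beta> u. \<exists>y\<in>\<beta> v. F e = {x, y}))" ..
  have conn: "connected_set H (\<beta> v)" if "v \<in> verts G" for v
    using \<beta> that by (simp add: model_def)
  show "minor G H"
    unfolding minor_def
  proof (intro exI[of _ "\<lambda>v. induced H (\<beta> v)"] exI[of _ F] conjI ballI)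
    fix v assume "v \<in> verts G"
    note c = conn[OF this]
    then show "subgraph (induced H (\<beta> v)) H"
      using H by (simp add: subgraph_induced connected_set_def)
    show "connected_graph (induced H (\<beta> v))"
      using H c by (rule connected_graph_induced)
  next
    show "disjoint_family_on (\<lambda>v. verts (induced H (\<beta> v))) (verts G)"
      using \<beta> by (simp add: model_def)
    show "\<forall>u v. {u, v} \<in> edges G \<longrightarrow> F {u, v} \<in> edges H \<and>
        (\<exists>x\<in>verts (induced H (\<beta> u)). \<exists>y\<in>verts (induced H (\<beta> v)). F {u, v} = {x, y})"
      using F by auto
  qed
qed

lemma connected_set_nonempty: "connected_set G S \<Longrightarrow> S \<noteq> {}"
  by (simp add: connected_set_def)

lemma connected_set_subset: "connected_set G S \<Longrightarrow> S \<subseteq> verts G"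
  by (simp add: connected_set_def)

lemma model_connected: "model G H \<beta> \<Longrightarrow> v \<in> verts G \<Longrightarrow> connected_set H (\<beta> v)"
  by (simp add: model_def)

lemma model_subset: "model G H \<beta> \<Longrightarrow> v \<in> verts G \<Longrightarrow> \<beta> v \<subseteq> verts H"
  by (rule connected_set_subset, rule model_connected)

lemma model_nonempty: "model G H \<beta> \<Longrightarrow> v \<in> verts G \<Longrightarrow> \<beta> v \<noteq> {}"
  by (rule connected_set_nonempty, rule model_connected)

lemma model_disjoint:
  assumes "model G H \<beta>" "u \<in> verts G" "v \<in> verts G" "x \<in> \<beta> u" "x \<in> \<beta> v"
  shows "u = v"
proof -
  have "disjoint_family_on \<beta> (verts G)" using assms(1) by (simp add: model_def)
  then show ?thesis using assms(2-) by (auto simp: disjoint_family_on_def)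
qed

lemma model_edge:
  assumes "model G H \<beta>" "{u, v} \<in> edges G"
  obtains x y where "x \<in> \<beta> u" "y \<in> \<beta> v" "{x, y} \<in> edges H"
proof -
  have "\<exists>x\<in>\<beta> u. \<exists>y\<in>\<beta> v. {x, y} \<in> edges H" using assms by (simp add: model_def)
  then show ?thesis by (elim bexE) (rule that)
qed

lemma modelI:
  assumes "\<And>v. v \<in> verts G \<Longrightarrow> connected_set H (\<beta> v)"
    and "\<And>u v x. u \<in> verts G \<Longrightarrow> v \<in> verts G \<Longrightarrow> x \<in> \<beta> u \<Longrightarrow> x \<in> \<beta> v \<Longrightarrow> u = v"
    and "\<And>u v. {u, v} \<in> edges G \<Longrightarrow> \<exists>x\<in>\<beta> u. \<exists>y\<in>\<beta> v. {x, y} \<in> edges H"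
  shows "model G H \<beta>"
  unfolding model_def
proof (intro conjI ballI allI impI assms(1,3))
  show "disjoint_family_on \<beta> (verts G)"
    unfolding disjoint_family_on_def
  proof (intro ballI impI)
    fix u v assume "u \<in> verts G" "v \<in> verts G" "u \<noteq> v"
    then show "\<beta> u \<inter> \<beta> v = {}" using assms(2)[of u v] by auto
  qed
qed

text \<open>A set that is closed under the edges of the union contains each branch set either entirely
  or not at all, and the vertices whose branch set it contains form a closed subset of \<open>S\<close>.\<close>

lemma connected_set_UN_model:
  assumes \<beta>: "model G H \<beta>" and S: "connected_set G S"
  shows "connected_set H (\<Union>v\<in>S. \<beta> v)"
proof (rule connected_setI)
  have SG: "S \<subseteq> verts G" "S \<noteq> {}" using S by (simp_all add: connected_set_def)
  then show "(\<Union>v\<in>S. \<beta> v) \<noteq> {}" using model_nonempty[OF \<beta>] by auto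
  show "(\<Union>v\<in>S. \<beta> v) \<subseteq> verts H" using SG(1) model_subset[OF \<beta>] by auto
  fix A x z
  assume x: "x \<in> A" "x \<in> (\<Union>v\<in>S. \<beta> v)" and z: "z \<in> (\<Union>v\<in>S. \<beta> v)"
    and closed: "\<And>x y. x \<in> A \<Longrightarrow> x \<in> (\<Union>v\<in>S. \<beta> v) \<Longrightarrow> y \<in> (\<Union>v\<in>S. \<beta> v) \<Longrightarrow>
      {x, y} \<in> edges H \<Longrightarrow> y \<in> A"
  have whole: "\<beta> v \<subseteq> A" if "v \<in> S" "y \<in> \<beta> v" "y \<in> A" for v y
  proof (rule connected_setD[OF model_connected[OF \<beta>] that(3,2)])
    show "v \<in> verts G" using that SG by blast
    show "q \<in> A" if "p \<in> A" "p \<in> \<beta> v" "q \<in> \<beta> v" "{p, q} \<in> edges H" for p q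
      using closed[of p q] that \<open>v \<in> S\<close> by simp blast
  qed
  obtain v where v: "v \<in> S" "x \<in> \<beta> v" using x by blast
  have "S \<subseteq> {v. \<beta> v \<subseteq> A}"
  proof (rule connected_setD[OF S, of v])
    show "v \<in> {v. \<beta> v \<subseteq> A}" using whole[OF v x(1)] by blast
    show "v \<in> S" by fact
    fix a b assume ab: "a \<in> {v. \<beta> v \<subseteq> A}" "a \<in> S" "b \<in> S" "{a, b} \<in> edges G"
    obtain p q where "p \<in> \<beta> a" "q \<in> \<beta> b" "{p, q} \<in> edges H"
      using model_edge[OF \<beta> ab(4)] .
    moreover from this have "q \<in> A" using ab by (intro closed[of p q]) auto
    ultimately show "b \<in> {v. \<beta> v \<subseteq> A}" using ab whole[of b q] by simp
  qed
  then show "z \<in> A" using z by blast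
qed

lemma model_comp:
  assumes \<beta>: "model G H \<beta>" and \<gamma>: "model H K \<gamma>"
  shows "model G K (\<lambda>v. \<Union>w\<in>\<beta> v. \<gamma> w)"
proof (rule modelI)
  fix v assume "v \<in> verts G"
  then show "connected_set K (\<Union>w\<in>\<beta> v. \<gamma> w)"
    by (intro connected_set_UN_model[OF \<gamma>] model_connected[OF \<beta>])
next
  fix u v x assume "u \<in> verts G" "v \<in> verts G" "x \<in> (\<Union>w\<in>\<beta> u. \<gamma> w)" "x \<in> (\<Union>w\<in>\<beta> v. \<gamma> w)"
  then obtain a b where "a \<in> \<beta> u" "b \<in> \<beta> v" "x \<in> \<gamma> a" "x \<in> \<gamma> b" "a \<in> verts H" "b \<in> verts H"
    using model_subset[OF \<beta>] by blast
  then show "u = v"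
    using model_disjoint[OF \<gamma>, of a b x] model_disjoint[OF \<beta>, of u v a] \<open>u \<in> verts G\<close> \<open>v \<in> verts G\<close>
    by simp
next
  fix u v assume uv: "{u, v} \<in> edges G"
  obtain x y where xy: "x \<in> \<beta> u" "y \<in> \<beta> v" "{x, y} \<in> edges H"
    using model_edge[OF \<beta> uv] .
  obtain p q where "p \<in> \<gamma> x" "q \<in> \<gamma> y" "{p, q} \<in> edges K"
    using model_edge[OF \<gamma> xy(3)] .
  then show "\<exists>x\<in>\<Union>w\<in>\<beta> u. \<gamma> w. \<exists>y\<in>\<Union>w\<in>\<beta> v. \<gamma> w. {x, y} \<in> edges K"
    using xy by (meson UN_I)
qed

lemma minor_trans:
  assumes "simple_graph G" "simple_graph H" "simple_graph K" "minor G H" "minor H K"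
  shows "minor G K"
proof -
  obtain \<beta> \<gamma> where "model G H \<beta>" "model H K \<gamma>"
    using assms by (auto simp: minor_iff_model)
  then have "model G K (\<lambda>v. \<Union>w\<in>\<beta> v. \<gamma> w)" by (rule model_comp)
  then show ?thesis using assms(1,3) by (auto simp: minor_iff_model)
qed

lemma minor_embedding:
  assumes "simple_graph G" "simple_graph H" "inj_on f (verts G)" "f ` verts G \<subseteq> verts H"
    and "\<And>u v. {u, v} \<in> edges G \<Longrightarrow> {f u, f v} \<in> edges H"
  shows "minor G H"
proof -
  have "model G H (\<lambda>v. {f v})"
  proof (rule modelI)
    show "connected_set H {f v}" if "v \<in> verts G" for v
      using that assms(4) by (intro connected_set_singleton) blast
    show "u = v" if "u \<in> verts G" "v \<in> verts G" "x \<in> {f u}" "x \<in> {f v}" for u v x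
      using that inj_onD[OF assms(3)] by simp
    show "\<exists>x\<in>{f u}. \<exists>y\<in>{f v}. {x, y} \<in> edges H" if "{u, v} \<in> edges G" for u v
      using assms(5)[OF that] by simp
  qed
  then show ?thesis using assms(1,2) by (auto simp: minor_iff_model)
qed

lemma minor_refl: "simple_graph G \<Longrightarrow> minor G G"
  by (rule minor_embedding[where f = id]) auto

lemma minor_induced: "simple_graph G \<Longrightarrow> S \<subseteq> verts G \<Longrightarrow> minor (induced G S) G"
  by (rule minor_embedding[where f = id]) (auto simp: simple_induced edges_induced)

text \<open>Pulling back along an injection \<open>f\<close> turns models inside a graph \<open>K\<close> that stay within the image
  of \<open>H\<close> into models in \<open>H\<close>.  It is applied to a summand of a disjoint union and to the base of a
  cone.\<close>

lemma connected_set_vimage: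
  assumes S: "connected_set K S" "S \<subseteq> f ` verts H" and f: "inj f"
    and e: "\<And>x y. {f x, f y} \<in> edges K \<Longrightarrow> {x, y} \<in> edges H"
  shows "connected_set H (f -` S)"
proof (rule connected_setI)
  have "S \<noteq> {}" using S by (simp add: connected_set_def)
  then show "f -` S \<noteq> {}" using S(2) by blast
  show "f -` S \<subseteq> verts H" using S(2) f by (auto dest: injD)
  fix A x z
  assume x: "x \<in> A" "x \<in> f -` S" and z: "z \<in> f -` S"
    and closed: "\<And>x y. x \<in> A \<Longrightarrow> x \<in> f -` S \<Longrightarrow> y \<in> f -` S \<Longrightarrow> {x, y} \<in> edges H \<Longrightarrow> y \<in> A"
  have "S \<subseteq> f ` A"
  proof (rule connected_setD[OF S(1), of "f x"])
    fix a b assume ab: "a \<in> f ` A" "a \<in> S" "b \<in> S" "{a, b} \<in> edges K"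
    obtain p where p: "a = f p" "p \<in> A" using ab(1) by blast
    obtain q where q: "b = f q" using ab(3) S(2) by blast
    have "{p, q} \<in> edges H" using ab(4) p q e by simp
    then have "q \<in> A" using closed[of p q] ab p q by simp
    then show "b \<in> f ` A" using q by blast
  qed (use x in auto)
  then show "z \<in> A" using z f by (auto dest: injD)
qed

lemma model_vimage:
  assumes \<beta>: "model G K \<beta>" and f: "inj f" and sub: "\<And>v. v \<in> verts G \<Longrightarrow> \<beta> v \<subseteq> f ` verts H"
    and e: "\<And>x y. {f x, f y} \<in> edges K \<Longrightarrow> {x, y} \<in> edges H" and G: "simple_graph G"
  shows "model G H (\<lambda>v. f -` \<beta> v)"
proof (rule modelI)
  show "connected_set H (f -` \<beta> v)" if "v \<in> verts G" for v
    using connected_set_vimage[OF model_connected[OF \<beta> that] sub[OF that] f e] .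
  show "u = v" if "u \<in> verts G" "v \<in> verts G" "x \<in> f -` \<beta> u" "x \<in> f -` \<beta> v" for u v x
    using that model_disjoint[OF \<beta>] by auto
  fix u v assume uv: "{u, v} \<in> edges G"
  obtain x y where xy: "x \<in> \<beta> u" "y \<in> \<beta> v" "{x, y} \<in> edges K"
    using model_edge[OF \<beta> uv] .
  obtain p where p: "x = f p" using xy(1) sub simple_edgeD(1)[OF G uv] by blast
  obtain q where q: "y = f q" using xy(2) sub simple_edgeD(2)[OF G uv] by blast
  have "p \<in> f -` \<beta> u" "q \<in> f -` \<beta> v" "{p, q} \<in> edges H"
    using xy p q e[of p q] by simp_all
  then show "\<exists>x\<in>f -` \<beta> u. \<exists>y\<in>f -` \<beta> v. {x, y} \<in> edges H" by meson
qed

lemma connected_set_induced: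
  assumes "connected_set G S" "S \<subseteq> X"
  shows "connected_set (induced G X) S"
proof (rule connected_setI)
  show "S \<noteq> {}" using assms(1) by (simp add: connected_set_def)
  show "S \<subseteq> verts (induced G X)" using assms(2) by simp
  fix A x z
  assume x: "x \<in> A" "x \<in> S" and z: "z \<in> S"
    and closed: "\<And>x y. x \<in> A \<Longrightarrow> x \<in> S \<Longrightarrow> y \<in> S \<Longrightarrow> {x, y} \<in> edges (induced G X) \<Longrightarrow> y \<in> A"
  have "S \<subseteq> A"
  proof (rule connected_setD[OF assms(1) x])
    fix x y assume xy: "x \<in> A" "x \<in> S" "y \<in> S" "{x, y} \<in> edges G"
    then have "{x, y} \<in> edges (induced G X)" using assms(2) by (auto simp: edges_induced)
    then show "y \<in> A" using xy closed by simp
  qed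
  then show "z \<in> A" using z by blast
qed

lemma model_into_induced:
  assumes "model G H \<beta>" "simple_graph G" "\<And>v. v \<in> verts G \<Longrightarrow> \<beta> v \<subseteq> X"
  shows "model G (induced H X) \<beta>"
proof (rule modelI)
  show "connected_set (induced H X) (\<beta> v)" if "v \<in> verts G" for v
    using model_connected[OF assms(1) that] assms(3)[OF that] by (rule connected_set_induced)
next
  fix u v x assume "u \<in> verts G" "v \<in> verts G" "x \<in> \<beta> u" "x \<in> \<beta> v"
  then show "u = v" using model_disjoint[OF assms(1)] by simp
next
  fix u v assume uv: "{u, v} \<in> edges G"
  obtain x y where xy: "x \<in> \<beta> u" "y \<in> \<beta> v" "{x, y} \<in> edges H"
    using model_edge[OF assms(1) uv] .
  moreover have "{x, y} \<subseteq> X"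
    using xy assms(3) simple_edgeD[OF assms(2) uv] by auto
  ultimately show "\<exists>x\<in>\<beta> u. \<exists>y\<in>\<beta> v. {x, y} \<in> edges (induced H X)"
    by (meson edges_induced)
qed

lemma model_from_induced:
  assumes "model G H \<beta>" "S \<subseteq> verts G"
  shows "model (induced G S) H \<beta>"
proof (rule modelI)
  show "connected_set H (\<beta> v)" if "v \<in> verts (induced G S)" for v
    using that assms by (auto intro: model_connected)
  show "u = v" if "u \<in> verts (induced G S)" "v \<in> verts (induced G S)" "x \<in> \<beta> u" "x \<in> \<beta> v" for u v x
    using that assms(2) by (intro model_disjoint[OF assms(1)]) auto
  show "\<exists>x\<in>\<beta> u. \<exists>y\<in>\<beta> v. {x, y} \<in> edges H" if "{u, v} \<in> edges (induced G S)" for u v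
    using that model_edge[OF assms(1), of u v] by (simp add: edges_induced) blast
qed

lemma card_le_if_minor:
  assumes "simple_graph G" "simple_graph H" "minor G H" "finite (verts H)"
  shows "card (verts G) \<le> card (verts H)"
proof -
  obtain \<beta> where \<beta>: "model G H \<beta>" using assms by (auto simp: minor_iff_model)
  let ?f = "\<lambda>v. SOME x. x \<in> \<beta> v"
  have f: "?f v \<in> \<beta> v" if "v \<in> verts G" for v
    using model_nonempty[OF \<beta> that] by (simp add: some_in_eq)
  have "inj_on ?f (verts G)"
  proof (rule inj_onI)
    fix u v assume uv: "u \<in> verts G" "v \<in> verts G" "?f u = ?f v"
    show "u = v" using model_disjoint[OF \<beta> uv(1,2) f[OF uv(1)]] f[OF uv(2)] uv(3) by simp
  qed
  moreover have "?f ` verts G \<subseteq> verts H"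
  proof (rule image_subsetI)
    show "?f v \<in> verts H" if "v \<in> verts G" for v
      using model_subset[OF \<beta> that] f[OF that] by (rule subsetD)
  qed
  ultimately show ?thesis using assms(4) by (rule card_inj_on_le)
qed

section \<open>Isomorphic copies\<close>

definition map_graph :: "('a \<Rightarrow> 'b) \<Rightarrow> 'a graph \<Rightarrow> 'b graph" where
  "map_graph f G = \<lparr>verts = f ` verts G, edges = (`) f ` edges G\<rparr>"

lemma verts_map_graph [simp]: "verts (map_graph f G) = f ` verts G"
  by (simp add: map_graph_def)

lemma simple_map_graph:
  assumes "simple_graph G" "inj_on f (verts G)"
  shows "simple_graph (map_graph f G)"
  unfolding simple_graph_def map_graph_def
proof clarsimp
  fix e assume e: "e \<in> edges G"
  then have "e \<subseteq> verts G" "card e = 2" using assms by (auto simp: simple_graph_def)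
  then show "f ` e \<subseteq> f ` verts G \<and> card (f ` e) = 2"
    using assms(2) by (auto simp: card_image inj_on_subset)
qed

lemma edges_map_graph_iff:
  assumes "simple_graph G" "inj_on f (verts G)" "u \<in> verts G" "v \<in> verts G"
  shows "{f u, f v} \<in> edges (map_graph f G) \<longleftrightarrow> {u, v} \<in> edges G"
proof -
  have "{u, v} = e" if "e \<in> edges G" "{f u, f v} = f ` e" for e
  proof -
    have "e \<subseteq> verts G" using that assms by (auto simp: simple_graph_def)
    then show ?thesis
      using that assms inj_on_image_eq_iff[OF assms(2), of "{u, v}" e] by auto
  qed
  then show ?thesis by (auto simp: map_graph_def)
qed

lemma minor_map_graph:
  assumes "simple_graph G" "inj_on f (verts G)"
  shows "minor G (map_graph f G)" "minor (map_graph f G) G"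
proof -
  note simple = assms(1) simple_map_graph[OF assms]
  show "minor G (map_graph f G)"
  proof (rule minor_embedding[where f = f])
    show "{f u, f v} \<in> edges (map_graph f G)" if "{u, v} \<in> edges G" for u v
      using that simple_edgeD[OF assms(1) that] assms by (simp add: edges_map_graph_iff)
  qed (use simple assms in auto)
  show "minor (map_graph f G) G"
  proof (rule minor_embedding[where f = "inv_into (verts G) f"])
    show "inj_on (inv_into (verts G) f) (verts (map_graph f G))"
      by (simp add: inj_on_inv_into)
    show "inv_into (verts G) f ` verts (map_graph f G) \<subseteq> verts G"
      using assms by auto
    fix u v assume uv: "{u, v} \<in> edges (map_graph f G)"
    then have "u \<in> f ` verts G" "v \<in> f ` verts G" using simple_edgeD[OF simple(2) uv] by auto
    then show "{inv_into (verts G) f u, inv_into (verts G) f v} \<in> edges G"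
      using uv assms by (auto simp: edges_map_graph_iff)
  qed (use simple in auto)
qed

lemma minor_map_graph_iff:
  assumes G: "simple_graph G" "inj_on f (verts G)" and H: "simple_graph H" "inj_on g (verts H)"
  shows "minor (map_graph f G) (map_graph g H) \<longleftrightarrow> minor G H"
proof
  note simple = G(1) H(1) simple_map_graph[OF G] simple_map_graph[OF H]
  note minors = minor_map_graph[OF G] minor_map_graph[OF H]
  show "minor G H" if "minor (map_graph f G) (map_graph g H)"
    by (rule minor_trans[OF simple(1,3,2) minors(1) minor_trans[OF simple(3,4,2) that minors(4)]])
  show "minor (map_graph f G) (map_graph g H)" if "minor G H"
    by (rule minor_trans[OF simple(3,1,4) minors(2) minor_trans[OF simple(1,2,4) that minors(3)]])
qed

lemma ex_nat_copy:
  fixes G :: "'a graph"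
  assumes "simple_graph G" "finite (verts G)"
  obtains K :: "nat graph" where "simple_graph K" "verts K = {..<card (verts G)}"
    "minor G K" "minor K G"
proof -
  obtain h where h: "bij_betw h (verts G) {0..<card (verts G)}"
    using ex_bij_betw_finite_nat[OF assms(2)] by blast
  then have inj: "inj_on h (verts G)" by (rule bij_betw_imp_inj_on)
  show ?thesis
    using that[of "map_graph h G"] simple_map_graph[OF assms(1) inj] minor_map_graph[OF assms(1) inj]
      bij_betw_imp_surj_on[OF h] by (simp add: lessThan_atLeast0)
qed

section \<open>Components\<close>

text \<open>Components are handled as vertex sets; \<open>component_induced_comp\<close> links them to maximal
  connected subgraphs.\<close>

definition comp_of :: "'a graph \<Rightarrow> 'a \<Rightarrow> 'a set" where
  "comp_of G x = {y. (x, y) \<in> (adj_rel G)\<^sup>*}"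

definition comps :: "'a graph \<Rightarrow> 'a set set" where
  "comps G = comp_of G ` verts G"

lemma sym_adj_rel: "sym (adj_rel G)"
  by (auto simp: adj_rel_def sym_def insert_commute)

lemma comp_of_self: "x \<in> comp_of G x"
  by (simp add: comp_of_def)

lemma comp_of_eq: "y \<in> comp_of G x \<Longrightarrow> comp_of G y = comp_of G x"
  using sym_rtrancl[OF sym_adj_rel, of G]
  by (auto simp: comp_of_def dest: symD intro: rtrancl_trans)

lemma comp_of_edge: "{x, y} \<in> edges G \<Longrightarrow> comp_of G x = comp_of G y"
  by (rule comp_of_eq) (auto simp: comp_of_def adj_rel_def insert_commute)

lemma comp_of_subset:
  assumes "simple_graph G" "x \<in> verts G"
  shows "comp_of G x \<subseteq> verts G"
proof
  fix y assume "y \<in> comp_of G x"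
  then have "(x, y) \<in> (adj_rel G)\<^sup>*" by (simp add: comp_of_def)
  then show "y \<in> verts G"
    by (induction rule: rtrancl_induct) (use assms simple_edgeD(2) in \<open>auto simp: adj_rel_def\<close>)
qed

lemma comps_eq: "C \<in> comps G \<Longrightarrow> x \<in> C \<Longrightarrow> comp_of G x = C"
  unfolding comps_def by (elim imageE) (simp add: comp_of_eq)

lemma comps_subset: "simple_graph G \<Longrightarrow> C \<in> comps G \<Longrightarrow> C \<subseteq> verts G"
  unfolding comps_def by (elim imageE) (simp add: comp_of_subset)

lemma comps_disjoint: "C \<in> comps G \<Longrightarrow> D \<in> comps G \<Longrightarrow> x \<in> C \<Longrightarrow> x \<in> D \<Longrightarrow> C = D"
  using comps_eq[of C G x] comps_eq[of D G x] by simp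

lemma connected_set_comp:
  assumes "simple_graph G" "C \<in> comps G"
  shows "connected_set G C"
proof (rule connected_setI)
  obtain y where "C = comp_of G y" using assms(2) by (auto simp: comps_def)
  then show "C \<noteq> {}" using comp_of_self[of y G] by blast
  show "C \<subseteq> verts G" using assms by (rule comps_subset)
  fix A x z
  assume x: "x \<in> A" "x \<in> C" and z: "z \<in> C"
    and closed: "\<And>x y. x \<in> A \<Longrightarrow> x \<in> C \<Longrightarrow> y \<in> C \<Longrightarrow> {x, y} \<in> edges G \<Longrightarrow> y \<in> A"
  have C: "C = comp_of G x" using comps_eq[OF assms(2) x(2)] by simp
  have "(x, z) \<in> (adj_rel G)\<^sup>*" using z by (simp add: C comp_of_def)
  then have "z \<in> A \<and> z \<in> C"
  proof (induction rule: rtrancl_induct)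
    case base
    then show ?case using x by blast
  next
    case (step y z)
    then have "z \<in> C" by (auto simp: C comp_of_def)
    then show ?case using step closed[of y z] by (simp add: adj_rel_def)
  qed
  then show "z \<in> A" by blast
qed

lemma connected_set_subset_comp_of:
  assumes "connected_set G S" "x \<in> S"
  shows "S \<subseteq> comp_of G x"
  by (rule connected_setD[OF assms(1) _ assms(2)])
    (auto simp: comp_of_def adj_rel_def intro: rtrancl_into_rtrancl)

lemma connected_set_in_comp:
  assumes "connected_set G S"
  obtains C where "C \<in> comps G" "S \<subseteq> C"
proof -
  obtain x where "x \<in> S" "x \<in> verts G" using assms by (auto simp: connected_set_def)
  then show ?thesis
    using that[of "comp_of G x"] connected_set_subset_comp_of[OF assms] by (auto simp: comps_def)
qed

lemma component_induced_comp:
  assumes G: "simple_graph G" and C: "C \<in> comps G"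
  shows "component (induced G C) G"
  unfolding component_def
proof (intro conjI allI impI)
  note conn = connected_set_comp[OF G C]
  show "subgraph (induced G C) G" using G comps_subset[OF G C] by (rule subgraph_induced)
  show "connected_graph (induced G C)" using G conn by (rule connected_graph_induced)
  fix D assume D: "subgraph D G \<and> connected_graph D \<and> subgraph (induced G C) D"
  have sub: "C \<subseteq> verts D" "edges (induced G C) \<subseteq> edges D" "edges D \<subseteq> edges G"
    using D by (auto simp: subgraph_def)
  obtain x where x: "x \<in> C" using connected_set_nonempty[OF conn] by blast
  have "connected_set G (verts D)" using D connected_subgraph_verts by blast
  then have "verts D \<subseteq> comp_of G x"
    using subsetD[OF sub(1) x] by (rule connected_set_subset_comp_of)
  then have verts: "verts D = C" using comps_eq[OF C x] sub(1) by simp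
  have "simple_graph D" using D by (simp add: subgraph_def)
  then have "edges D \<subseteq> edges (induced G C)"
    using sub(3) verts by (auto simp: edges_induced simple_graph_def)
  then show "D = induced G C" using sub(2) verts by (intro graph.equality) auto
qed

text \<open>Every connected set lies in a component, and every component is spanned by a connected set, so
  membership in \<open>UF\<close> bounds all connected sets, branch sets in particular.\<close>

lemma UF_iff:
  "G \<in> UF \<longleftrightarrow> simple_graph G \<and> countable (verts G) \<and> (\<forall>S. connected_set G S \<longrightarrow> finite S)"
proof
  assume G: "G \<in> UF"
  then have simple: "simple_graph G" by (simp add: UF_def)
  have "finite S" if S: "connected_set G S" for S
  proof -
    obtain C where C: "C \<in> comps G" "S \<subseteq> C" using connected_set_in_comp[OF S] .
    have "\<forall>C. component C G \<longrightarrow> finite (verts C)" using G by (simp add: UF_def)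
    then have "finite (verts (induced G C))"
      using component_induced_comp[OF simple C(1)] by (elim allE impE)
    then show ?thesis using C(2) by (simp add: finite_subset)
  qed
  then show "simple_graph G \<and> countable (verts G) \<and> (\<forall>S. connected_set G S \<longrightarrow> finite S)"
    using G by (simp add: UF_def)
next
  assume "simple_graph G \<and> countable (verts G) \<and> (\<forall>S. connected_set G S \<longrightarrow> finite S)"
  then show "G \<in> UF"
    using connected_subgraph_verts by (fastforce simp: UF_def component_def)
qed


lemma UF_simple: "G \<in> UF \<Longrightarrow> simple_graph G"
  by (simp add: UF_iff)

lemma finite_comps: "G \<in> UF \<Longrightarrow> C \<in> comps G \<Longrightarrow> finite C"
  by (simp add: UF_iff connected_set_comp)

lemma connected_set_of_induced:
  assumes "connected_set (induced G X) S" "X \<subseteq> verts G"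
  shows "connected_set G S"
proof (rule connected_setI)
  show "S \<noteq> {}" using assms(1) by (rule connected_set_nonempty)
  show "S \<subseteq> verts G" using connected_set_subset[OF assms(1)] assms(2) by simp
  fix A x z
  assume x: "x \<in> A" "x \<in> S" and z: "z \<in> S"
    and closed: "\<And>x y. x \<in> A \<Longrightarrow> x \<in> S \<Longrightarrow> y \<in> S \<Longrightarrow> {x, y} \<in> edges G \<Longrightarrow> y \<in> A"
  have "S \<subseteq> A"
    by (rule connected_setD[OF assms(1) x]) (rule closed, auto simp: edges_induced)
  then show "z \<in> A" using z by blast
qed

lemma model_out_of_induced:
  assumes "model G (induced H X) \<beta>" "X \<subseteq> verts H"
  shows "model G H \<beta>"
proof (rule modelI)
  show "connected_set H (\<beta> v)" if "v \<in> verts G" for v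
    using model_connected[OF assms(1) that] assms(2) by (rule connected_set_of_induced)
  show "u = v" if "u \<in> verts G" "v \<in> verts G" "x \<in> \<beta> u" "x \<in> \<beta> v" for u v x
    using that by (rule model_disjoint[OF assms(1)])
  show "\<exists>x\<in>\<beta> u. \<exists>y\<in>\<beta> v. {x, y} \<in> edges H" if uv: "{u, v} \<in> edges G" for u v
  proof -
    obtain x y where "x \<in> \<beta> u" "y \<in> \<beta> v" "{x, y} \<in> edges (induced H X)"
      using model_edge[OF assms(1) uv] .
    then show ?thesis by (auto simp: edges_induced)
  qed
qed

text \<open>Models of the parts of \<open>G\<close> in pairwise disjoint regions \<open>Q P\<close> of \<open>H\<close> combine to a model of \<open>G\<close>,
  provided that no edge of \<open>G\<close> joins different parts.\<close>

lemma minor_by_parts: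
  assumes G: "simple_graph G" and H: "simple_graph H" and cover: "verts G = \<Union>\<P>"
    and disjoint: "\<And>P P' v. P \<in> \<P> \<Longrightarrow> P' \<in> \<P> \<Longrightarrow> v \<in> P \<Longrightarrow> v \<in> P' \<Longrightarrow> P = P'"
    and closed: "\<And>P u v. P \<in> \<P> \<Longrightarrow> {u, v} \<in> edges G \<Longrightarrow> u \<in> P \<Longrightarrow> v \<in> P"
    and models: "\<And>P. P \<in> \<P> \<Longrightarrow> \<exists>\<beta>. model (induced G P) H \<beta> \<and> (\<forall>v\<in>P. \<beta> v \<subseteq> Q P)"
    and Q: "\<And>P P' x. P \<in> \<P> \<Longrightarrow> P' \<in> \<P> \<Longrightarrow> x \<in> Q P \<Longrightarrow> x \<in> Q P' \<Longrightarrow> P = P'"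
  shows "minor G H"
proof -
  have "\<exists>\<beta>. \<forall>P\<in>\<P>. model (induced G P) H (\<beta> P) \<and> (\<forall>v\<in>P. \<beta> P v \<subseteq> Q P)"
    using models by (intro bchoice) simp
  then obtain \<beta> where \<beta>: "\<And>P. P \<in> \<P> \<Longrightarrow> model (induced G P) H (\<beta> P)"
    "\<And>P v. P \<in> \<P> \<Longrightarrow> v \<in> P \<Longrightarrow> \<beta> P v \<subseteq> Q P"
    by auto
  define part where "part v = (SOME P. P \<in> \<P> \<and> v \<in> P)" for v
  have part: "part v \<in> \<P>" "v \<in> part v" if "v \<in> verts G" for v
    using that someI_ex[of "\<lambda>P. P \<in> \<P> \<and> v \<in> P"] by (auto simp: part_def cover)
  have "model G H (\<lambda>v. \<beta> (part v) v)"
  proof (rule modelI)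
    show "connected_set H (\<beta> (part v) v)" if "v \<in> verts G" for v
      using model_connected[OF \<beta>(1)[OF part(1)[OF that]], of v] part(2)[OF that] by simp
  next
    fix u v x assume uv: "u \<in> verts G" "v \<in> verts G"
      and x: "x \<in> \<beta> (part u) u" "x \<in> \<beta> (part v) v"
    have "x \<in> Q (part u)" "x \<in> Q (part v)"
      using x \<beta>(2)[OF part[OF uv(1)]] \<beta>(2)[OF part[OF uv(2)]] by auto
    then have "part u = part v" using Q[of "part u" "part v" x] part(1) uv by simp
    then show "u = v"
      using model_disjoint[OF \<beta>(1)[OF part(1)[OF uv(1)]], of u v x] part(2)[OF uv(1)]
        part(2)[OF uv(2)] x by simp
  next
    fix u v assume uv: "{u, v} \<in> edges G"
    note u = simple_edgeD(1)[OF G uv] and v = simple_edgeD(2)[OF G uv]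
    have "v \<in> part u" using closed[OF part(1)[OF u] uv part(2)[OF u]] .
    then have eq: "part v = part u" using disjoint[OF part(1)[OF v] part(1)[OF u] part(2)[OF v]] by simp
    have "{u, v} \<in> edges (induced G (part u))"
      using uv part(2)[OF u] \<open>v \<in> part u\<close> by (simp add: edges_induced)
    then obtain x y where "x \<in> \<beta> (part u) u" "y \<in> \<beta> (part u) v" "{x, y} \<in> edges H"
      using model_edge[OF \<beta>(1)[OF part(1)[OF u]]] by metis
    then show "\<exists>x\<in>\<beta> (part u) u. \<exists>y\<in>\<beta> (part v) v. {x, y} \<in> edges H"
      unfolding eq by (intro bexI)
  qed
  then show ?thesis using G H by (auto simp: minor_iff_model)
qed

section \<open>Sequences in quasi-orders\<close>

text \<open>If each \<open>i\<close> is related to all sufficiently large \<open>j\<close>, then jumping each time beyond the bound of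
  the current index yields a subsequence all of whose pairs are related.\<close>

lemma eventually_diagonal:
  fixes P :: "nat \<Rightarrow> nat \<Rightarrow> bool"
  assumes "\<And>i. \<exists>g. \<forall>j\<ge>g. P i j"
  shows "\<exists>r :: nat \<Rightarrow> nat. strict_mono r \<and> (\<forall>k l. k < l \<longrightarrow> P (r k) (r l))"
proof -
  have "\<exists>g>i. \<forall>j\<ge>g. P i j" for i
  proof -
    obtain g where "\<forall>j\<ge>g. P i j" using assms by blast
    then show ?thesis by (intro exI[of _ "max g (Suc i)"]) auto
  qed
  then obtain g where g: "\<And>i. g i > i" "\<And>i j. j \<ge> g i \<Longrightarrow> P i j" by metis
  define r where "r k = (g ^^ k) 0" for k
  have mono: "strict_mono r" using g(1) by (intro strict_mono_Suc_iff[THEN iffD2]) (simp add: r_def)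
  have "P (r k) (r l)" if "k < l" for k l
  proof (rule g(2))
    have "r (Suc k) \<le> r l" using mono that by (simp add: strict_mono_less_eq)
    then show "g (r k) \<le> r l" by (simp add: r_def)
  qed
  then show ?thesis using mono by (intro exI[of _ r]) simp
qed

text \<open>Dependent choice in which the \<open>n\<close>-th element is chosen subject to a condition on the finite set
  of its predecessors.\<close>

lemma choice_avoiding_past:
  fixes P :: "nat \<Rightarrow> 'a set \<Rightarrow> 'a \<Rightarrow> bool"
  assumes "\<And>n A. finite A \<Longrightarrow> A \<subseteq> X \<Longrightarrow> \<exists>x\<in>X. P n A x"
  obtains q where "\<And>n. q n \<in> X" "\<And>n. P n (q ` {..<n}) (q n)"
proof -
  define h where "h n A = (SOME x. x \<in> X \<and> P n A x)" for n A
  have h: "h n A \<in> X \<and> P n A (h n A)" if "finite A" "A \<subseteq> X" for n A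
    using assms[OF that, of n] someI_ex[of "\<lambda>x. x \<in> X \<and> P n A x"] by (auto simp: h_def)
  define past where "past = rec_nat {} (\<lambda>n A. insert (h n A) A)"
  have past: "past 0 = {}" "past (Suc n) = insert (h n (past n)) (past n)" for n
    by (simp_all add: past_def)
  define q where "q n = h n (past n)" for n
  have image: "q ` {..<n} = past n" for n
    by (induction n) (simp_all add: past lessThan_Suc q_def)
  have sub: "finite (past n) \<and> past n \<subseteq> X" for n
    by (induction n) (simp_all add: past h)
  show ?thesis
  proof (rule that[of q])
    show "q n \<in> X" for n using h sub by (simp add: q_def)
    show "P n (q ` {..<n}) (q n)" for n unfolding image unfolding q_def using h sub by simp
  qed
qed

text \<open>Otherwise each element of a sequence in \<open>S\<close> is below only finitely many others, and the diagonal
  subsequence is bad.  The map \<open>g\<close> is there because \<open>S\<close> will consist of components, of which many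
  can induce comparable graphs.\<close>

lemma wqo_infinite_above:
  assumes wqo: "well_quasi_ordered Q le" and S: "infinite S" and g: "g ` S \<subseteq> Q"
  obtains a where "a \<in> S" "infinite {b \<in> S. le (g a) (g b)}"
proof -
  have "\<exists>a\<in>S. infinite {b \<in> S. le (g a) (g b)}"
  proof (rule ccontr)
    assume "\<not> ?thesis"
    then have fin: "\<And>a. a \<in> S \<Longrightarrow> finite {b \<in> S. le (g a) (g b)}" by simp
    obtain f :: "nat \<Rightarrow> _" where f: "inj f" "range f \<subseteq> S"
      using infinite_countable_subset[OF S] by blast
    have "\<exists>m. \<forall>j\<ge>m. \<not> le (g (f i)) (g (f j))" for i
    proof -
      have "finite (f -` {b \<in> S. le (g (f i)) (g b)})"
        using f by (intro finite_vimageI fin) auto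
      then obtain m where "\<forall>j\<in>f -` {b \<in> S. le (g (f i)) (g b)}. j < m"
        by (auto simp: finite_nat_set_iff_bounded)
      then show ?thesis using f(2) by (intro exI[of _ m]) fastforce
    qed
    then have "\<exists>r :: nat \<Rightarrow> nat. strict_mono r \<and> (\<forall>k l. k < l \<longrightarrow> \<not> le (g (f (r k))) (g (f (r l))))"
      by (rule eventually_diagonal)
    then obtain r :: "nat \<Rightarrow> nat"
      where "\<And>k l. k < l \<Longrightarrow> \<not> le (g (f (r k))) (g (f (r l)))" by auto
    moreover have "range (\<lambda>k. g (f (r k))) \<subseteq> Q" using f(2) g by blast
    ultimately show False using wqo unfolding well_quasi_ordered_def by metis
  qed
  then show ?thesis using that by blast
qed

text \<open>The complement of a down-closed set is generated by finitely many elements: otherwise one could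
  keep choosing elements of it that are not above any earlier choice, and obtain a bad sequence.  So
  every down-closed set is determined by a finite subset of \<open>Q\<close>.\<close>

lemma countable_down_closed_sets:
  assumes wqo: "well_quasi_ordered Q le" and Q: "countable Q"
  shows "countable {D. D \<subseteq> Q \<and> (\<forall>x\<in>D. \<forall>y\<in>Q. le y x \<longrightarrow> y \<in> D)}"
proof -
  let ?avoid = "\<lambda>B. {x \<in> Q. \<not> (\<exists>b\<in>B. le b x)}"
  have basis: "\<exists>B. finite B \<and> B \<subseteq> Q \<and> D = ?avoid B"
    if D: "D \<subseteq> Q" "\<forall>x\<in>D. \<forall>y\<in>Q. le y x \<longrightarrow> y \<in> D" for D
  proof (rule ccontr)
    assume *: "\<not> ?thesis"
    have "\<exists>x\<in>Q - D. \<not> (\<exists>b\<in>A. le b x)" if A: "finite A" "A \<subseteq> Q - D" for A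
    proof -
      have "D \<subseteq> ?avoid A" using D A by blast
      moreover have "D \<noteq> ?avoid A" using * A by blast
      ultimately show ?thesis by blast
    qed
    then obtain q where q: "\<And>n::nat. q n \<in> Q - D" "\<And>n. \<not> (\<exists>b\<in>q ` {..<n}. le b (q n))"
      using choice_avoiding_past[of "Q - D" "\<lambda>n A x. \<not> (\<exists>b\<in>A. le b x)"] by metis
    have "range q \<subseteq> Q" using q(1) by blast
    then obtain i j where "i < j" "le (q i) (q j)"
      using wqo unfolding well_quasi_ordered_def by metis
    then show False using q(2)[of j] by blast
  qed
  have "{D. D \<subseteq> Q \<and> (\<forall>x\<in>D. \<forall>y\<in>Q. le y x \<longrightarrow> y \<in> D)} \<subseteq> ?avoid ` {B. finite B \<and> B \<subseteq> Q}"
  proof (intro subsetI)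
    fix D assume "D \<in> {D. D \<subseteq> Q \<and> (\<forall>x\<in>D. \<forall>y\<in>Q. le y x \<longrightarrow> y \<in> D)}"
    then obtain B where "finite B" "B \<subseteq> Q" "D = ?avoid B" using basis[of D] by auto
    then show "D \<in> ?avoid ` {B. finite B \<and> B \<subseteq> Q}" by (intro image_eqI) simp_all
  qed
  moreover have "countable (?avoid ` {B. finite B \<and> B \<subseteq> Q})"
    using countable_Collect_finite_subset[OF Q] by (rule countable_image)
  ultimately show ?thesis by (rule countable_subset)
qed

text \<open>Greedily, along an enumeration of \<open>R\<close>.\<close>

lemma countable_injective_choice:
  assumes R: "countable R" and T: "\<And>C. C \<in> R \<Longrightarrow> infinite (T C)"
  shows "\<exists>\<phi>. inj_on \<phi> R \<and> (\<forall>C\<in>R. \<phi> C \<in> T C)"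
proof (cases "R = {}")
  case True
  then show ?thesis by simp
next
  case False
  have "\<exists>x\<in>UNIV. x \<in> T (from_nat_into R n) - A" if "finite A" for n A
    using infinite_imp_nonempty[OF Diff_infinite_finite[OF that T[OF from_nat_into[OF False]]]] by blast
  then obtain q where q: "\<And>n. q n \<in> T (from_nat_into R n) - q ` {..<n}"
    using choice_avoiding_past[of UNIV "\<lambda>n A x. x \<in> T (from_nat_into R n) - A"] by metis
  have "inj q"
  proof (rule linorder_injI)
    fix i j :: nat assume "i < j"
    then have "q i \<in> q ` {..<j}" by simp
    then show "q i \<noteq> q j" using q[of j] by auto
  qed
  show ?thesis
  proof (intro exI[of _ "\<lambda>C. q (to_nat_on R C)"] conjI ballI)
    show "inj_on (\<lambda>C. q (to_nat_on R C)) R"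
      using \<open>inj q\<close> inj_on_to_nat_on[OF R] by (auto simp: inj_on_def)
    show "q (to_nat_on R C) \<in> T C" if "C \<in> R" for C
      using q[of "to_nat_on R C"] that R by simp
  qed
qed

section \<open>Finite minors determine the twin class\<close>

text \<open>Every finite graph has an isomorphic copy on natural numbers.  Restricting to such copies keeps
  the set of all finite graphs countable, whatever the vertex type of \<open>G\<close>.\<close>

definition fin_minors :: "'a graph \<Rightarrow> nat graph set" where
  "fin_minors G = {K \<in> finite_graphs. minor K G}"

lemma well_quasi_ordered_minor_iff:
  "well_quasi_ordered (finite_graphs :: 'a::infinite graph set) minor \<longleftrightarrow>
    (\<forall>q :: nat \<Rightarrow> 'a graph. range q \<subseteq> finite_graphs \<longrightarrow> (\<exists>i j. i < j \<and> minor (q i) (q j)))"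
proof -
  have "reflp_on (finite_graphs :: 'a graph set) minor"
    by (rule reflp_onI) (simp add: finite_graphs_def minor_refl)
  moreover have "transp_on (finite_graphs :: 'a graph set) minor"
    by (rule transp_onI, rule minor_trans) (auto simp: finite_graphs_def)
  ultimately show ?thesis by (simp add: well_quasi_ordered_def)
qed

lemma wqo_nat_finite_graphs:
  assumes "well_quasi_ordered (finite_graphs :: 'a::infinite graph set) minor"
  shows "well_quasi_ordered (finite_graphs :: nat graph set) minor"
  unfolding well_quasi_ordered_minor_iff
proof (intro allI impI)
  fix q :: "nat \<Rightarrow> nat graph" assume q: "range q \<subseteq> finite_graphs"
  obtain f :: "nat \<Rightarrow> 'a" where "inj f"
    using infinite_countable_subset[OF infinite_UNIV] by blast
  then have inj: "inj_on f A" for A by (rule inj_on_subset) simp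
  have simple: "simple_graph (q i)" "finite (verts (q i))" for i
    using q by (auto simp: finite_graphs_def)
  have "range (\<lambda>i. map_graph f (q i)) \<subseteq> finite_graphs"
    using simple inj by (auto simp: finite_graphs_def simple_map_graph)
  then obtain i j where "i < j" "minor (map_graph f (q i)) (map_graph f (q j))"
    using assms[unfolded well_quasi_ordered_minor_iff, rule_format, of "\<lambda>i. map_graph f (q i)"]
    by blast
  then show "\<exists>i j. i < j \<and> minor (q i) (q j)"
    using minor_map_graph_iff[OF simple(1) inj simple(1) inj, of i j] by blast
qed

lemma countable_nat_finite_graphs: "countable (finite_graphs :: nat graph set)"
proof -
  let ?g = "\<lambda>(V, E). \<lparr>verts = V, edges = E\<rparr> :: nat graph"
  have fin: "countable {A :: nat set. finite A}"
    using countable_Collect_finite_subset[of "UNIV :: nat set"] by simp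
  have "finite_graphs \<subseteq> ?g ` ({A. finite A} \<times> {E. finite E \<and> E \<subseteq> {A. finite A}})"
  proof
    fix G :: "nat graph" assume G: "G \<in> finite_graphs"
    then have "edges G \<subseteq> Pow (verts G)" "finite (verts G)"
      by (auto simp: finite_graphs_def simple_graph_def)
    then have "finite (verts G)" "finite (edges G)" "edges G \<subseteq> {A. finite A}"
      by (auto intro: finite_subset)
    then show "G \<in> ?g ` ({A. finite A} \<times> {E. finite E \<and> E \<subseteq> {A. finite A}})"
      by (intro image_eqI[of _ _ "(verts G, edges G)"]) auto
  qed
  moreover have "countable (?g ` ({A. finite A} \<times> {E. finite E \<and> E \<subseteq> {A. finite A}}))"
    by (intro countable_image countable_SIGMA fin countable_Collect_finite_subset)
  ultimately show ?thesis by (rule countable_subset)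
qed

lemma minor_induced_of_fin_minors:
  assumes G: "simple_graph G" and H: "simple_graph H" and sub: "fin_minors G \<subseteq> fin_minors H"
    and U: "finite U" "U \<subseteq> verts G"
  shows "minor (induced G U) H"
proof -
  have GU: "simple_graph (induced G U)" using G by (rule simple_induced)
  obtain K :: "nat graph" where K: "simple_graph K" "verts K = {..<card (verts (induced G U))}"
    "minor (induced G U) K" "minor K (induced G U)"
    using ex_nat_copy[OF GU] U(1) by auto
  have "minor K G" using K(1) GU G K(4) minor_induced[OF G U(2)] by (rule minor_trans)
  then have "K \<in> fin_minors G" using K by (simp add: fin_minors_def finite_graphs_def)
  then have "minor K H" using sub by (auto simp: fin_minors_def)
  then show ?thesis using minor_trans[OF GU K(1) H K(3)] by blast
qed

text \<open>Here \<open>R\<close> is the set of recurrent components of \<open>G\<close>, \<open>P\<close> the finite union of the others, and \<open>X\<close>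
  the finite set of vertices of \<open>H\<close> used by a model of \<open>P\<close>.  The recurrent components are sent to
  different components of \<open>H\<close> that miss \<open>X\<close>.\<close>

lemma minor_if_fin_minors_subset:
  fixes G H :: "'a::infinite graph"
  assumes wqo: "well_quasi_ordered (finite_graphs :: 'a graph set) minor"
    and G: "G \<in> UF" and H: "H \<in> UF" and sub: "fin_minors G \<subseteq> fin_minors H"
  shows "minor G H"
proof -
  note GH = UF_simple[OF G] UF_simple[OF H]
  note ind = simple_induced[OF GH(1)] simple_induced[OF GH(2)]
  let ?le = "\<lambda>C D. minor (induced G C) (induced G D)"
  define R where "R = {C \<in> comps G. infinite {D \<in> comps G. ?le C D}}"
  define N where "N = comps G - R"
  have "finite N"
  proof (rule ccontr)
    assume "infinite N"
    moreover have "induced G ` N \<subseteq> finite_graphs"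
      using ind finite_comps[OF G] by (auto simp: N_def finite_graphs_def)
    ultimately obtain C where C: "C \<in> N" "infinite {D \<in> N. ?le C D}"
      by (rule wqo_infinite_above[OF wqo])
    have "{D \<in> N. ?le C D} \<subseteq> {D \<in> comps G. ?le C D}" by (auto simp: N_def)
    then have "C \<in> R" using C by (auto simp: R_def N_def dest: finite_subset)
    then show False using C(1) by (simp add: N_def)
  qed
  define P where "P = \<Union>N"
  have P: "finite P" "P \<subseteq> verts G"
    using \<open>finite N\<close> finite_comps[OF G] comps_subset[OF GH(1)] by (auto simp: P_def N_def)
  have "minor (induced G P) H"
    using GH sub P by (rule minor_induced_of_fin_minors)
  then obtain \<beta> where \<beta>: "model (induced G P) H \<beta>"
    using ind(1) GH(2) by (auto simp: minor_iff_model)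
  define X where "X = (\<Union>v\<in>P. \<beta> v)"
  have "finite (\<beta> v)" if "v \<in> P" for v
    using H model_connected[OF \<beta>, of v] that by (simp add: UF_iff)
  then have X: "finite X" using P(1) by (simp add: X_def)
  have many: "infinite {D \<in> comps H. minor (induced G C) (induced H D)}" if C: "C \<in> R" for C
  proof
    \<comment> \<open>If the set \<open>?D\<close> of suitable components were finite, it would offer only finitely many vertices.
      Take one more component of \<open>G\<close> above \<open>C\<close> than that.  Each of them is mapped into a
      single component of \<open>H\<close>, which then belongs to \<open>?D\<close>, so they occupy too many disjoint sets.\<close>
    let ?D = "{D \<in> comps H. minor (induced G C) (induced H D)}"
    assume fin: "finite ?D"
    have fin': "finite (\<Union>?D)" using fin finite_comps[OF H] by auto
    have "infinite {D \<in> comps G. ?le C D}" using C by (simp add: R_def)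
    then obtain M where M: "finite M" "card M = Suc (card (\<Union>?D))" "M \<subseteq> {D \<in> comps G. ?le C D}"
      using infinite_arbitrarily_large[of _ "Suc (card (\<Union>?D))"] by blast
    define U where "U = \<Union>M"
    have U: "finite U" "U \<subseteq> verts G"
      using M finite_comps[OF G] comps_subset[OF GH(1)] by (auto simp: U_def)
    have "minor (induced G U) H"
      using GH sub U by (rule minor_induced_of_fin_minors)
    then obtain \<gamma> where \<gamma>: "model (induced G U) H \<gamma>"
      using ind(1) GH(2) by (auto simp: minor_iff_model)
    let ?S = "\<lambda>E. \<Union>v\<in>E. \<gamma> v"
    have S: "?S E \<noteq> {} \<and> ?S E \<subseteq> \<Union>?D" if E: "E \<in> M" for E
    proof -
      have E': "E \<in> comps G" "?le C E" "E \<subseteq> U" using E M(3) by (auto simp: U_def)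
      have "connected_set (induced G U) E"
        using connected_set_comp[OF GH(1) E'(1)] E'(3) by (rule connected_set_induced)
      with \<gamma> have conn: "connected_set H (?S E)" by (rule connected_set_UN_model)
      then obtain D where D: "D \<in> comps H" "?S E \<subseteq> D" by (rule connected_set_in_comp)
      have eq: "induced (induced G U) E = induced G E"
        using E'(3) by (auto simp: induced_def)
      have "model (induced G E) H \<gamma>"
        using model_from_induced[OF \<gamma>, of E] E'(3) by (simp add: eq)
      then have "model (induced G E) (induced H D) \<gamma>"
        using ind(1) D(2) by (rule_tac model_into_induced) auto
      then have "minor (induced G E) (induced H D)"
        using ind by (auto simp: minor_iff_model)
      then have "minor (induced G C) (induced H D)"
        using minor_trans[OF ind(1) ind(1) ind(2) E'(2)] by blast
      then show ?thesis using D connected_set_nonempty[OF conn] by blast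
    qed
    have disj: "E = E'" if E: "E \<in> M" "E' \<in> M" "x \<in> ?S E" "x \<in> ?S E'" for E E' x
    proof -
      obtain u v where uv: "u \<in> E" "v \<in> E'" "x \<in> \<gamma> u" "x \<in> \<gamma> v" using E by auto
      have "u = v"
        using uv E(1,2) by (intro model_disjoint[OF \<gamma>, of u v x]) (auto simp: U_def)
      then show ?thesis using uv E M(3) comps_disjoint[of E G E' u] by auto
    qed
    let ?f = "\<lambda>E. SOME x. x \<in> ?S E"
    have f: "?f E \<in> ?S E" if "E \<in> M" for E
      using S[OF that] by (intro some_in_eq[THEN iffD2]) blast
    have "inj_on ?f M"
    proof (rule inj_onI)
      fix E E' assume E: "E \<in> M" "E' \<in> M" "?f E = ?f E'"
      have "?f E \<in> ?S E'" using f[OF E(2)] E(3) by simp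
      then show "E = E'" by (rule disj[OF E(1,2) f[OF E(1)]])
    qed
    moreover have "?f ` M \<subseteq> \<Union>?D"
    proof (rule image_subsetI)
      show "?f E \<in> \<Union>?D" if "E \<in> M" for E
        using S[OF that] f[OF that] by (meson subsetD)
    qed
    ultimately have "card M \<le> card (\<Union>?D)" using fin' by (rule card_inj_on_le)
    then show False using M(2) by simp
  qed
  let ?T = "\<lambda>C. {D \<in> comps H. minor (induced G C) (induced H D)} - comp_of H ` X"
  have "countable R"
    using G by (auto simp: R_def comps_def UF_iff intro: countable_subset[of _ "comp_of G ` verts G"])
  moreover have "infinite (?T C)" if "C \<in> R" for C
    using many[OF that] X by (intro Diff_infinite_finite) auto
  ultimately have "\<exists>\<phi>. inj_on \<phi> R \<and> (\<forall>C\<in>R. \<phi> C \<in> ?T C)"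
    by (rule countable_injective_choice)
  then obtain \<phi> where \<phi>: "inj_on \<phi> R" "\<And>C. C \<in> R \<Longrightarrow> \<phi> C \<in> ?T C"
    by (elim exE conjE) simp
  have \<phi>_comps: "\<phi> C \<in> comps H" if "C \<in> R" for C using \<phi>(2)[OF that] by blast
  have \<phi>_X: "\<phi> C \<inter> X = {}" if C: "C \<in> R" for C
  proof (rule equals0I)
    fix x assume x: "x \<in> \<phi> C \<inter> X"
    then have "comp_of H x = \<phi> C" using comps_eq[OF \<phi>_comps[OF C]] by blast
    then show False using \<phi>(2)[OF C] x by blast
  qed
  have RN: "R \<union> N = comps G" "R \<inter> N = {}" by (auto simp: R_def N_def)
  have P_notin: "P \<notin> R"
  proof
    assume "P \<in> R"
    then obtain x where x: "x \<in> P"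
      using RN(1) connected_set_nonempty[OF connected_set_comp[OF GH(1), of P]] by blast
    then obtain C where "C \<in> N" "x \<in> C" by (auto simp: P_def)
    then have "C = P" using comps_disjoint[of C G P x] x RN(1) \<open>P \<in> R\<close> by blast
    then show False using RN(2) \<open>C \<in> N\<close> \<open>P \<in> R\<close> by blast
  qed
  have part_comp: "comp_of G v \<subseteq> B" if B: "B \<in> insert P R" "v \<in> B" for B v
  proof (cases "B = P")
    case True
    then obtain C where C: "C \<in> N" "v \<in> C" using B(2) by (auto simp: P_def)
    then have "comp_of G v = C" using comps_eq[of C G v] RN(1) by blast
    then show ?thesis using C True by (auto simp: P_def)
  next
    case False
    then have "comp_of G v = B" using B comps_eq[of B G v] RN(1) by blast
    then show ?thesis by simp
  qed
  have apart: "False" if C: "C \<in> R" "v \<in> C" "v \<in> P" for C v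
  proof -
    obtain D where D: "D \<in> N" "v \<in> D" using C(3) by (auto simp: P_def)
    then have "C = D" using C comps_disjoint[of C G D v] RN(1) by blast
    then show False using D C RN(2) by blast
  qed
  show ?thesis
  proof (rule minor_by_parts[OF GH, where \<P> = "insert P R" and Q = "\<lambda>B. if B = P then X else \<phi> B"])
    have "verts G = \<Union>(comps G)"
      using comps_subset[OF GH(1)] comp_of_self[of _ G] by (auto simp: comps_def)
    then show "verts G = \<Union>(insert P R)" using RN(1) by (auto simp: P_def)
  next
    fix B B' v assume "B \<in> insert P R" "B' \<in> insert P R" "v \<in> B" "v \<in> B'"
    then show "B = B'" using apart comps_disjoint[of B G B' v] RN(1) by blast
  next
    fix B u v assume "B \<in> insert P R" "{u, v} \<in> edges G" "u \<in> B"
    then show "v \<in> B" using part_comp[of B u] comp_of_edge[of u v G] comp_of_self[of v G] by blast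
  next
    fix B assume B: "B \<in> insert P R"
    show "\<exists>\<beta>. model (induced G B) H \<beta> \<and> (\<forall>v\<in>B. \<beta> v \<subseteq> (if B = P then X else \<phi> B))"
    proof (cases "B = P")
      case True
      then show ?thesis using \<beta> by (intro exI[of _ \<beta>]) (auto simp: X_def)
    next
      case False
      then have BR: "B \<in> R" using B by simp
      then have "minor (induced G B) (induced H (\<phi> B))" using \<phi>(2) by blast
      then obtain \<gamma> where \<gamma>: "model (induced G B) (induced H (\<phi> B)) \<gamma>"
        using ind by (auto simp: minor_iff_model)
      have "model (induced G B) H \<gamma>"
        using \<gamma> comps_subset[OF GH(2) \<phi>_comps[OF BR]] by (rule model_out_of_induced)
      moreover have "\<gamma> v \<subseteq> \<phi> B" if "v \<in> B" for v
        using model_subset[OF \<gamma>, of v] that by simp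
      ultimately show ?thesis using False by (intro exI[of _ \<gamma>]) simp
    qed
  next
    fix B B' x assume B: "B \<in> insert P R" "B' \<in> insert P R"
      and x: "x \<in> (if B = P then X else \<phi> B)" "x \<in> (if B' = P then X else \<phi> B')"
    show "B = B'"
    proof (cases "B = P \<or> B' = P")
      case True
      then show ?thesis using B x \<phi>_X[of B] \<phi>_X[of B'] by (auto split: if_splits)
    next
      case False
      then have BR: "B \<in> R" "B' \<in> R" and "x \<in> \<phi> B" "x \<in> \<phi> B'" using B x by auto
      then have "\<phi> B = \<phi> B'" using comps_disjoint[OF \<phi>_comps \<phi>_comps] by metis
      then show ?thesis using \<phi>(1) BR by (simp add: inj_on_eq_iff)
    qed
  qed
qed

lemma minor_twins_iff_fin_minors:
  fixes G H :: "'a::infinite graph"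
  assumes wqo: "well_quasi_ordered (finite_graphs :: 'a graph set) minor"
    and G: "G \<in> UF" and H: "H \<in> UF"
  shows "minor_twins G H \<longleftrightarrow> fin_minors G = fin_minors H"
proof
  have mono: "fin_minors G \<subseteq> fin_minors H" if "minor G H" "G \<in> UF" "H \<in> UF" for G H :: "'a graph"
  proof
    fix K assume "K \<in> fin_minors G"
    then have "simple_graph K" "minor K G" "K \<in> finite_graphs"
      by (simp_all add: fin_minors_def finite_graphs_def)
    then show "K \<in> fin_minors H"
      using minor_trans[OF _ UF_simple[OF that(2)] UF_simple[OF that(3)] _ that(1)]
      by (simp add: fin_minors_def)
  qed
  show "fin_minors G = fin_minors H" if "minor_twins G H"
    using that mono G H by (simp add: minor_twins_def subset_antisym)
  show "minor_twins G H" if "fin_minors G = fin_minors H"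
    using that minor_if_fin_minors_subset[OF wqo] G H by (simp add: minor_twins_def)
qed

section \<open>Counting twin classes\<close>

definition twins :: "'a graph set \<Rightarrow> 'a graph rel" where
  "twins \<C> = {(G, H). G \<in> \<C> \<and> H \<in> \<C> \<and> minor_twins G H}"

lemma twin_classes_eq: "twin_classes \<C> = (\<lambda>G. twins \<C> `` {G}) ` \<C>"
  by (auto simp: twin_classes_def twins_def quotient_def)

lemma minor_twins_if_same_class:
  assumes "G \<in> UF" "H \<in> UF" "twins UF `` {G} = twins UF `` {H}"
  shows "minor_twins G H"
proof -
  have "H \<in> twins UF `` {H}"
    using assms(2) minor_refl[OF UF_simple[OF assms(2)]] by (simp add: twins_def minor_twins_def)
  then have "H \<in> twins UF `` {G}" using assms(3) by simp
  then show ?thesis by (simp add: twins_def)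
qed

lemma inj_twin_class:
  assumes "\<And>i. f i \<in> UF" "\<And>i j. minor_twins (f i) (f j) \<Longrightarrow> i = j"
  shows "inj (\<lambda>i. twins UF `` {f i})" "range (\<lambda>i. twins UF `` {f i}) \<subseteq> twin_classes UF"
proof -
  show "inj (\<lambda>i. twins UF `` {f i})"
  proof (rule injI)
    fix i j assume "twins UF `` {f i} = twins UF `` {f j}"
    then show "i = j" using assms(2) minor_twins_if_same_class[OF assms(1) assms(1)] by blast
  qed
  show "range (\<lambda>i. twins UF `` {f i}) \<subseteq> twin_classes UF"
    using assms(1) by (auto simp: twin_classes_eq)
qed

lemma countable_twin_classes_UF:
  assumes wqo: "well_quasi_ordered (finite_graphs :: 'a::infinite graph set) minor"
  shows "countable (twin_classes (UF :: 'a graph set))"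
proof -
  have "fin_minors ` (UF :: 'a graph set) \<subseteq>
      {D. D \<subseteq> finite_graphs \<and> (\<forall>K\<in>D. \<forall>L\<in>finite_graphs. minor L K \<longrightarrow> L \<in> D)}"
  proof (intro image_subsetI CollectI conjI ballI impI)
    fix G :: "'a graph" and K L :: "nat graph"
    assume G: "G \<in> UF"
    show "fin_minors G \<subseteq> finite_graphs" by (auto simp: fin_minors_def)
    assume K: "K \<in> fin_minors G" and L: "L \<in> finite_graphs" "minor L K"
    have "minor L G"
      using K L by (intro minor_trans[OF _ _ UF_simple[OF G] L(2)])
        (simp_all add: fin_minors_def finite_graphs_def)
    then show "L \<in> fin_minors G" using L by (simp add: fin_minors_def)
  qed
  then have fin: "countable (fin_minors ` (UF :: 'a graph set))"
    using countable_down_closed_sets[OF wqo_nat_finite_graphs[OF wqo] countable_nat_finite_graphs]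
    by (rule countable_subset)
  have "twins UF `` {G} = {H \<in> UF. fin_minors H = fin_minors G}" if "G \<in> UF" for G :: "'a graph"
    using that minor_twins_iff_fin_minors[OF wqo that] by (auto simp: twins_def)
  then have "twin_classes (UF :: 'a graph set) =
      (\<lambda>D. {H \<in> UF. fin_minors H = D}) ` fin_minors ` (UF :: 'a graph set)"
    by (simp add: twin_classes_eq image_image)
  then show ?thesis using fin by simp
qed

lemma finite_graph_UF: "G \<in> finite_graphs \<Longrightarrow> G \<in> UF"
  by (auto simp: UF_iff finite_graphs_def countable_finite
      dest: connected_set_subset intro: finite_subset)

lemma infinite_twin_classes_UF: "infinite (twin_classes (UF :: 'a::infinite graph set))"
proof -
  obtain f :: "nat \<Rightarrow> 'a" where f: "inj f"
    using infinite_countable_subset[OF infinite_UNIV] by blast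
  define E :: "nat \<Rightarrow> 'a graph" where "E n = \<lparr>verts = f ` {..<n}, edges = {}\<rparr>" for n
  have E: "simple_graph (E n)" "finite (verts (E n))" for n
    by (simp_all add: E_def simple_graph_def)
  have card: "card (verts (E n)) = n" for n
    using f by (simp add: E_def card_image inj_on_subset)
  have UF: "E n \<in> UF" for n using E by (intro finite_graph_UF) (simp add: finite_graphs_def)
  have "m = n" if "minor_twins (E m) (E n)" for m n
    using that card_le_if_minor[OF E(1) E(1) _ E(2), of m n]
      card_le_if_minor[OF E(1) E(1) _ E(2), of n m] by (simp add: minor_twins_def card)
  then show ?thesis using inj_twin_class[of E, OF UF] range_inj_infinite finite_subset by metis
qed

section \<open>An antichain of connected finite graphs\<close>

text \<open>A bad sequence contains only finitely many members of each order, since two of its members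
  cannot have the same copy on an initial segment of the naturals.  A subsequence with strictly
  increasing orders is an antichain: later members are too large to be minors of earlier ones.\<close>

lemma infinite_antichain:
  assumes "\<not> well_quasi_ordered (finite_graphs :: 'a::infinite graph set) minor"
  shows "\<exists>p :: nat \<Rightarrow> nat graph. (\<forall>i. p i \<in> finite_graphs) \<and> (\<forall>i j. minor (p i) (p j) \<longrightarrow> i = j)"
proof -
  obtain q :: "nat \<Rightarrow> 'a graph" where q: "range q \<subseteq> finite_graphs"
    and bad: "\<And>i j. i < j \<Longrightarrow> \<not> minor (q i) (q j)"
    using assms unfolding well_quasi_ordered_minor_iff by blast
  have q': "simple_graph (q i)" "finite (verts (q i))" for i
    using q by (auto simp: finite_graphs_def)
  have "\<exists>K :: nat graph. simple_graph K \<and> verts K = {..<card (verts (q i))} \<and>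
      minor (q i) K \<and> minor K (q i)" for i
    using ex_nat_copy[OF q'] by metis
  then obtain p :: "nat \<Rightarrow> nat graph" where p: "\<And>i. simple_graph (p i)"
    "\<And>i. verts (p i) = {..<card (verts (q i))}" "\<And>i. minor (q i) (p i)" "\<And>i. minor (p i) (q i)"
    by metis
  let ?c = "\<lambda>i. card (verts (p i))"
  have bad_p: "\<not> minor (p i) (p j)" if "i < j" for i j
  proof
    assume "minor (p i) (p j)"
    then have "minor (q i) (p j)" by (rule minor_trans[OF q'(1) p(1) p(1) p(3)])
    then have "minor (q i) (q j)" by (rule minor_trans[OF q'(1) p(1) q'(1) _ p(4)])
    then show False using bad[OF that] by blast
  qed
  have "inj p"
  proof (rule linorder_injI)
    fix i j :: nat assume "i < j"
    then show "p i \<noteq> p j" using bad_p[of i j] minor_refl[OF p(1), of i] by auto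
  qed
  have "\<exists>g. \<forall>j\<ge>g. ?c i < ?c j" for i
  proof -
    let ?S = "{j. ?c j \<le> ?c i}"
    let ?g = "\<lambda>(V, E). \<lparr>verts = V, edges = E\<rparr> :: nat graph"
    have "p ` ?S \<subseteq> ?g ` (Pow {..<?c i} \<times> Pow (Pow {..<?c i}))"
    proof (rule image_subsetI)
      fix j assume "j \<in> ?S"
      then have "verts (p j) \<subseteq> {..<?c i}" using p(2)[of j] by auto
      moreover have "edges (p j) \<subseteq> Pow (verts (p j))"
        using p(1)[of j] by (auto simp: simple_graph_def)
      ultimately show "p j \<in> ?g ` (Pow {..<?c i} \<times> Pow (Pow {..<?c i}))"
        by (intro image_eqI[of _ _ "(verts (p j), edges (p j))"]) auto
    qed
    then have "finite (p ` ?S)" by (rule finite_subset) simp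
    then have "finite ?S" using \<open>inj p\<close> by (meson finite_imageD inj_on_subset subset_UNIV)
    then obtain m where "\<forall>j\<in>?S. j < m" by (auto simp: finite_nat_set_iff_bounded)
    then have "\<forall>j\<ge>m. ?c i < ?c j" by (auto simp: not_le[symmetric])
    then show ?thesis ..
  qed
  then have "\<exists>r :: nat \<Rightarrow> nat. strict_mono r \<and> (\<forall>k l. k < l \<longrightarrow> ?c (r k) < ?c (r l))"
    by (rule eventually_diagonal)
  then obtain r :: "nat \<Rightarrow> nat" where r: "strict_mono r" "\<And>k l. k < l \<Longrightarrow> ?c (r k) < ?c (r l)"
    by auto
  show ?thesis
  proof (intro exI[of _ "\<lambda>k. p (r k)"] conjI allI impI)
    show "p (r k) \<in> finite_graphs" for k using p(1,2) by (simp add: finite_graphs_def)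
    fix k l assume kl: "minor (p (r k)) (p (r l))"
    have "\<not> k < l" using kl bad_p strict_monoD[OF r(1)] by blast
    moreover have "?c (r k) \<le> ?c (r l)" using p(2) by (intro card_le_if_minor p(1) kl) simp
    then have "\<not> l < k" using r(2)[of l k] by linarith
    ultimately show "k = l" by simp
  qed
qed

definition cone :: "'a graph \<Rightarrow> 'a option graph" where
  "cone G = \<lparr>verts = insert None (Some ` verts G),
    edges = (`) Some ` edges G \<union> (\<lambda>v. {None, Some v}) ` verts G\<rparr>"

lemma verts_cone [simp]: "verts (cone G) = insert None (Some ` verts G)"
  by (simp add: cone_def)

lemma cone_edge_Some: "{Some u, Some v} \<in> edges (cone G) \<longleftrightarrow> {u, v} \<in> edges G"
proof -
  have "{Some u, Some v} = Some ` e \<longleftrightarrow> e = {u, v}" for e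
    using inj_image_eq_iff[of Some "{u, v}" e] by auto
  then show ?thesis by (auto simp: cone_def image_iff doubleton_eq_iff)
qed

lemma cone_edge_None: "v \<in> verts G \<Longrightarrow> {None, Some v} \<in> edges (cone G)"
  by (simp add: cone_def)

lemma simple_cone:
  assumes "simple_graph G"
  shows "simple_graph (cone G)"
  unfolding simple_graph_def
proof
  fix e assume "e \<in> edges (cone G)"
  then consider d where "d \<in> edges G" "e = Some ` d" | v where "v \<in> verts G" "e = {None, Some v}"
    by (auto simp: cone_def)
  then show "e \<subseteq> verts (cone G) \<and> card e = 2"
    by cases (use assms in \<open>auto simp: simple_graph_def card_image\<close>)
qed

lemma connected_set_cone: "connected_set (cone G) (verts (cone G))"
proof (rule connected_setI)
  fix A x z
  assume x: "x \<in> A" "x \<in> verts (cone G)" and z: "z \<in> verts (cone G)"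
    and closed: "\<And>x y. x \<in> A \<Longrightarrow> x \<in> verts (cone G) \<Longrightarrow> y \<in> verts (cone G) \<Longrightarrow>
      {x, y} \<in> edges (cone G) \<Longrightarrow> y \<in> A"
  have "None \<in> A"
  proof (cases x)
    case (Some v)
    then have "{x, None} \<in> edges (cone G)"
      using x(2) cone_edge_None[of v G] by (auto simp: insert_commute)
    then show ?thesis using closed x by simp
  qed (use x in simp)
  then show "z \<in> A"
    using z closed[of None z] cone_edge_None[of _ G] by (cases z) auto
qed auto

text \<open>At most one branch set contains the apex of \<open>cone H\<close>.  If it belongs to a vertex \<open>v\<close> of \<open>G\<close>, the
  branch set of the apex of \<open>cone G\<close> is free to replace it, as that apex is adjacent to all
  neighbours of \<open>v\<close>.  The map \<open>\<sigma>\<close> carries out this exchange, after which the apex of \<open>cone H\<close> is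
  not used any more.\<close>

lemma minor_if_minor_cone:
  assumes G: "simple_graph G" and H: "simple_graph H" and minor: "minor (cone G) (cone H)"
  shows "minor G H"
proof -
  obtain \<beta> where \<beta>: "model (cone G) (cone H) \<beta>"
    using minor simple_cone[OF G] simple_cone[OF H] by (auto simp: minor_iff_model)
  define \<sigma> where "\<sigma> v = (if None \<in> \<beta> (Some v) then None else Some v)" for v
  have \<sigma>: "\<sigma> v \<in> verts (cone G)" if "v \<in> verts G" for v
    using that by (simp add: \<sigma>_def)
  have unique: "u = v" if "u \<in> verts G" "v \<in> verts G" "None \<in> \<beta> (Some u)" "None \<in> \<beta> (Some v)" for u v
    using that model_disjoint[OF \<beta>, of "Some u" "Some v" None] by simp
  have \<sigma>_inj: "u = v" if "u \<in> verts G" "v \<in> verts G" "\<sigma> u = \<sigma> v" for u v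
    using that unique by (auto simp: \<sigma>_def split: if_splits)
  have no_apex: "None \<notin> \<beta> (\<sigma> v)" if "v \<in> verts G" for v
    using that model_disjoint[OF \<beta>, of None "Some v" None] by (auto simp: \<sigma>_def)
  have "model G (cone H) (\<lambda>v. \<beta> (\<sigma> v))"
  proof (rule modelI)
    show "connected_set (cone H) (\<beta> (\<sigma> v))" if "v \<in> verts G" for v
      using \<sigma>[OF that] by (rule model_connected[OF \<beta>])
    show "u = v" if "u \<in> verts G" "v \<in> verts G" "x \<in> \<beta> (\<sigma> u)" "x \<in> \<beta> (\<sigma> v)" for u v x
      using that model_disjoint[OF \<beta> \<sigma> \<sigma>, of u v x] \<sigma>_inj by blast
    fix u v assume uv: "{u, v} \<in> edges G"
    note verts = simple_edgeD[OF G uv]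
    have "{\<sigma> u, \<sigma> v} \<in> edges (cone G)"
      using verts unique[of u v] uv cone_edge_None[of u G] cone_edge_None[of v G]
      by (auto simp: \<sigma>_def cone_edge_Some insert_commute)
    then obtain x y where "x \<in> \<beta> (\<sigma> u)" "y \<in> \<beta> (\<sigma> v)" "{x, y} \<in> edges (cone H)"
      by (rule model_edge[OF \<beta>])
    then show "\<exists>x\<in>\<beta> (\<sigma> u). \<exists>y\<in>\<beta> (\<sigma> v). {x, y} \<in> edges (cone H)" by (intro bexI)
  qed
  moreover have "\<beta> (\<sigma> v) \<subseteq> Some ` verts H" if "v \<in> verts G" for v
    using model_subset[OF \<beta> \<sigma>[OF that]] no_apex[OF that] by auto
  ultimately have "model G H (\<lambda>v. Some -` \<beta> (\<sigma> v))"
    using G by (intro model_vimage[where K = "cone H"]) (simp_all add: cone_edge_Some)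
  then show ?thesis using G H by (auto simp: minor_iff_model)
qed

section \<open>Disjoint unions over subsets of an antichain\<close>

definition disjoint_union :: "'i set \<Rightarrow> ('i \<Rightarrow> 'a graph) \<Rightarrow> ('i \<times> 'a) graph" where
  "disjoint_union A p = \<lparr>verts = (SIGMA i:A. verts (p i)),
    edges = (\<Union>i\<in>A. (`) (Pair i) ` edges (p i))\<rparr>"

lemma verts_disjoint_union [simp]: "verts (disjoint_union A p) = (SIGMA i:A. verts (p i))"
  by (simp add: disjoint_union_def)

lemma edges_disjoint_unionE:
  assumes "e \<in> edges (disjoint_union A p)"
  obtains i d where "i \<in> A" "d \<in> edges (p i)" "e = Pair i ` d"
  using assms by (auto simp: disjoint_union_def)

lemma simple_disjoint_union:
  assumes "\<And>i. i \<in> A \<Longrightarrow> simple_graph (p i)"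
  shows "simple_graph (disjoint_union A p)"
  unfolding simple_graph_def
proof
  fix e assume "e \<in> edges (disjoint_union A p)"
  then obtain i d where id: "i \<in> A" "d \<in> edges (p i)" "e = Pair i ` d"
    by (rule edges_disjoint_unionE)
  then have "d \<subseteq> verts (p i)" "card d = 2" using assms by (auto simp: simple_graph_def)
  then show "e \<subseteq> verts (disjoint_union A p) \<and> card e = 2"
    using id by (auto simp: card_image inj_on_def)
qed

lemma disjoint_union_edge_fst: "{x, y} \<in> edges (disjoint_union A p) \<Longrightarrow> fst x = fst y"
proof (elim edges_disjoint_unionE)
  fix i d assume "{x, y} = Pair i ` d"
  then have "x \<in> Pair i ` d" "y \<in> Pair i ` d" by (metis insertI1 insertI2)+
  then show "fst x = fst y" by auto
qed

lemma disjoint_union_edge_iff: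
  assumes "i \<in> A"
  shows "{(i, x), (i, y)} \<in> edges (disjoint_union A p) \<longleftrightarrow> {x, y} \<in> edges (p i)"
proof
  assume "{(i, x), (i, y)} \<in> edges (disjoint_union A p)"
  then obtain j d where jd: "d \<in> edges (p j)" "{(i, x), (i, y)} = Pair j ` d"
    by (rule edges_disjoint_unionE)
  have "(i, x) \<in> Pair j ` d" using jd(2) by blast
  then have "i = j" by auto
  then have "Pair i ` {x, y} = Pair i ` d" using jd(2) by simp
  then have "{x, y} = d" by (subst (asm) inj_image_eq_iff) (auto simp: inj_on_def)
  then show "{x, y} \<in> edges (p i)" using jd(1) \<open>i = j\<close> by simp
next
  assume "{x, y} \<in> edges (p i)"
  then have "Pair i ` {x, y} \<in> edges (disjoint_union A p)"
    using assms unfolding disjoint_union_def by (simp del: image_insert) blast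
  then show "{(i, x), (i, y)} \<in> edges (disjoint_union A p)" by simp
qed

lemma connected_set_disjoint_union:
  assumes "connected_set (disjoint_union A p) S"
  obtains i where "i \<in> A" "S \<subseteq> Pair i ` verts (p i)"
proof -
  have verts: "S \<subseteq> (SIGMA i:A. verts (p i))" using connected_set_subset[OF assms] by simp
  obtain i x where ix: "(i, x) \<in> S" using connected_set_nonempty[OF assms] by auto
  have "S \<subseteq> {y. fst y = i}"
    by (rule connected_setD[OF assms _ ix]) (auto dest: disjoint_union_edge_fst)
  then have "S \<subseteq> Pair i ` verts (p i)" using verts by fastforce
  moreover have "i \<in> A" using verts ix by blast
  ultimately show ?thesis using that by blast
qed

lemma minor_into_disjoint_union:
  assumes "\<And>i. i \<in> A \<Longrightarrow> simple_graph (p i)" "i \<in> A"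
  shows "minor (p i) (disjoint_union A p)"
  using assms
  by (intro minor_embedding[where f = "Pair i"])
    (auto simp: simple_disjoint_union disjoint_union_edge_iff inj_on_def)

lemma connected_minor_of_disjoint_union:
  assumes p: "\<And>i. i \<in> A \<Longrightarrow> simple_graph (p i)" and G: "simple_graph G"
    and conn: "connected_set G (verts G)" and minor: "minor G (disjoint_union A p)"
  obtains i where "i \<in> A" "minor G (p i)"
proof -
  obtain \<beta> where \<beta>: "model G (disjoint_union A p) \<beta>"
    using minor G simple_disjoint_union[of A p, OF p] by (auto simp: minor_iff_model)
  obtain i where i: "i \<in> A" "(\<Union>v\<in>verts G. \<beta> v) \<subseteq> Pair i ` verts (p i)"
    using connected_set_disjoint_union[OF connected_set_UN_model[OF \<beta> conn]] .
  have "model G (p i) (\<lambda>v. Pair i -` \<beta> v)"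
    using G i by (intro model_vimage[OF \<beta>]) (auto simp: disjoint_union_edge_iff inj_on_def)
  then have "minor G (p i)" using G p[OF i(1)] by (auto simp: minor_iff_model)
  then show ?thesis using that i(1) by blast
qed

text \<open>Disjoint unions change the vertex type; this brings them back to the given infinite type.\<close>

lemma map_graph_UF:
  assumes G: "simple_graph G" "countable (verts G)" "\<And>S. connected_set G S \<Longrightarrow> finite S"
    and f: "inj f"
  shows "map_graph f G \<in> UF"
  unfolding UF_iff
proof (intro conjI allI impI)
  show "simple_graph (map_graph f G)" "countable (verts (map_graph f G))"
    using G f by (auto intro: simple_map_graph inj_on_subset)
  fix S assume S: "connected_set (map_graph f G) S"
  have sub: "S \<subseteq> f ` verts G" using connected_set_subset[OF S] by simp
  have "{x, y} \<in> edges G" if xy: "{f x, f y} \<in> edges (map_graph f G)" for x y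
  proof -
    obtain e where e: "e \<in> edges G" "f ` {x, y} = f ` e" using xy by (auto simp: map_graph_def)
    then show ?thesis using inj_image_eq_iff[OF f] by metis
  qed
  then have "connected_set G (f -` S)" by (rule connected_set_vimage[OF S sub f])
  then have "finite (f ` (f -` S))" using G(3) by blast
  moreover have "f ` (f -` S) = S" using sub by auto
  ultimately show "finite S" by simp
qed

text \<open>For an antichain \<open>p\<close>, the index set \<open>A\<close> can be recovered from the disjoint union \<open>U A\<close> of the cones
  \<open>cone (p i)\<close> with \<open>i \<in> A\<close>: it consists of the \<open>i\<close> for which \<open>cone (p i)\<close> is a minor of \<open>U A\<close>.\<close>

lemma uncountable_twin_classes_UF:
  assumes "\<not> well_quasi_ordered (finite_graphs :: 'a::infinite graph set) minor"
  shows "uncountable (twin_classes (UF :: 'a graph set))"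
proof
  assume count: "countable (twin_classes (UF :: 'a graph set))"
  obtain p :: "nat \<Rightarrow> nat graph" where p: "\<And>i. p i \<in> finite_graphs"
    and antichain: "\<And>i j. minor (p i) (p j) \<Longrightarrow> i = j"
    using infinite_antichain[OF assms] by auto
  obtain f0 :: "nat \<Rightarrow> 'a" where f0: "inj f0"
    using infinite_countable_subset[OF infinite_UNIV] by blast
  define f :: "nat \<times> nat option \<Rightarrow> 'a" where "f = f0 \<circ> to_nat"
  have f: "inj f" unfolding f_def using f0 inj_to_nat by (rule inj_compose)
  let ?c = "\<lambda>i. cone (p i)"
  have simple: "simple_graph (p i)" for i using p by (simp add: finite_graphs_def)
  have simple_c: "simple_graph (?c i)" for i using simple by (rule simple_cone)
  note simple_U = simple_disjoint_union[where p = ?c, OF simple_c]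
  define U where "U A = map_graph f (disjoint_union A ?c)" for A
  have UF: "U A \<in> UF" for A
    unfolding U_def
  proof (rule map_graph_UF[OF simple_U _ _ f])
    show "countable (verts (disjoint_union A ?c))" by simp
    fix S assume "connected_set (disjoint_union A ?c) S"
    then obtain i where "S \<subseteq> Pair i ` verts (?c i)" by (rule connected_set_disjoint_union)
    moreover have "finite (verts (?c i))" using p by (simp add: finite_graphs_def)
    ultimately show "finite S" by (meson finite_imageI finite_subset)
  qed
  have sub: "A \<subseteq> B" if AB: "minor (U A) (U B)" for A B
  proof
    fix i assume i: "i \<in> A"
    have "minor (disjoint_union A ?c) (disjoint_union B ?c)"
      using AB f unfolding U_def
      by (subst (asm) minor_map_graph_iff) (auto intro: simple_U inj_on_subset)
    then have "minor (?c i) (disjoint_union B ?c)"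
      by (rule minor_trans[OF simple_c simple_U simple_U minor_into_disjoint_union[OF simple_c i]])
    then obtain j where j: "j \<in> B" "minor (?c i) (?c j)"
      by (rule connected_minor_of_disjoint_union[OF simple_c simple_c connected_set_cone])
    then have "i = j" using antichain minor_if_minor_cone[OF simple simple] by blast
    then show "i \<in> B" using j(1) by simp
  qed
  have "A = B" if "minor_twins (U A) (U B)" for A B
    using that sub by (simp add: minor_twins_def subset_antisym)
  note inj = inj_twin_class[of U, OF UF this]
  have "countable (range (\<lambda>A. twins UF `` {U A}))" using inj(2) count by (rule countable_subset)
  then have "countable (UNIV :: nat set set)" using inj(1) by (rule countable_image_inj_on)
  then have "range (from_nat_into (UNIV :: nat set set)) = Pow UNIV"
    by (simp add: range_from_nat_into)
  then show False using Cantors_theorem[of "UNIV :: nat set"] by blast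
qed

theorem corollary4p2:
  shows "card_minor (UF :: 'a::infinite graph set) =o natLeq \<longleftrightarrow>
    well_quasi_ordered (finite_graphs :: 'a graph set) minor"
proof -
  let ?T = "twin_classes (UF :: 'a graph set)"
  have "|?T| =o natLeq \<longleftrightarrow> |?T| =o |UNIV :: nat set|"
    using card_of_nat ordIso_symmetric ordIso_transitive by blast
  also have "\<dots> \<longleftrightarrow> countable ?T"
  proof
    assume "|?T| =o |UNIV :: nat set|"
    then obtain f where "bij_betw f ?T (UNIV :: nat set)" by (auto simp: card_of_ordIso[symmetric])
    then show "countable ?T" by (simp add: countableI_bij2)
  next
    assume "countable ?T"
    then have "bij_betw (to_nat_on ?T) ?T UNIV"
      using infinite_twin_classes_UF by (rule to_nat_on_infinite)
    then show "|?T| =o |UNIV :: nat set|" by (auto simp: card_of_ordIso[symmetric])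
  qed
  also have "\<dots> \<longleftrightarrow> well_quasi_ordered (finite_graphs :: 'a graph set) minor"
    using countable_twin_classes_UF uncountable_twin_classes_UF by blast
  finally show ?thesis by (simp add: card_minor_def)
qed

end
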